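(* Let $f'=[1,3,7,0,1,1]=x^2+3y^2+7z^2+xz+xy$, and let $C$ be a smooth curve of genus $2$ with $q_C\sim 4f'$. Then $f'$ represents all positive odd integers (Kaplansky's conjecture for $f'$) if and only if $(J_C,\theta_C)\in\mathcal{H}_\infty:=\bigcap_N H_{4N}$, where $N$ runs over all positive odd square-free integers.
   Context: For a principally polarized abelian surface $(A,\theta)$ over an algebraically closed field $K$ of characteristic $0$ (with $\theta\in\mathrm{NS}(A)$ the class of the polarization), the form $\tilde q_{(A,\theta)}(D)=(D.\theta)^2-2(D.D)$ on $\mathrm{NS}(A)$ induces a positive definite quadratic form $q_{(A,\theta)}$ on $\mathrm{NS}(A)/\mathbb{Z}\theta$, the refined Humbert invariant, regarded as an equivalence class of integral quadratic forms. For a genus $2$ curve $C/K$ with Jacobian $J_C$ and theta divisor class $\theta_C$, $q_C:=q_{(J_C,\theta_C)}$. $\sim$ is $\mathrm{GL}_n(\mathbb{Z})$-equivalence of integral quadratic forms. For a form $q$, $q\rightarrow N$ means that $q$ primitively represents $N$, i.e. $q(x)=N$ for an integer vector $x$ whose coordinates have gcd $1$. For a positive integer $N$, the Humbert surface of invariant $N$ is $H_N=\{\langle A,\theta\rangle\in\mathcal{A}_2(K): q_{(A,\theta)}\rightarrow N\}$, where $\mathcal{A}_2(K)$ is the moduli space of principally polarized abelian surfaces over $K$. *)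

theory Defs
  imports
    "HOL-Analysis.Abstract_Topology"
    "HOL-Library.Poly_Mapping"
    "HOL-Library.Function_Algebras"
    "HOL-Algebra.Free_Abelian_Groups"
    "HOL-Algebra.Generated_Groups"
    "HOL-Computational_Algebra.Squarefree"
    "HOL-Computational_Algebra.Polynomial"
    "Jordan_Normal_Form.Matrix"
begin

section \<open>Integral quadratic forms\<close>

text \<open>A form of rank \<open>n\<close> is a pair of \<open>n\<close> and its evaluation map; only the values on
  \<open>carrier_vec n\<close> are relevant.\<close>

type_synonym qform = "nat \<times> (int vec \<Rightarrow> int)"

definition integral_form :: "qform \<Rightarrow> bool" where
  "integral_form Q \<longleftrightarrow> (\<exists>a :: nat \<Rightarrow> nat \<Rightarrow> int. \<forall>x \<in> carrier_vec (fst Q).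
     snd Q x = (\<Sum>j<fst Q. \<Sum>i\<le>j. a i j * x $ i * x $ j))"

definition form_equiv :: "qform \<Rightarrow> qform \<Rightarrow> bool" (infix \<open>\<sim>\<^sub>Z\<close> 50) where
  "Q \<sim>\<^sub>Z Q' \<longleftrightarrow> fst Q = fst Q' \<and>
     (\<exists>U \<in> carrier_mat (fst Q) (fst Q). invertible_mat U \<and>
        (\<forall>x \<in> carrier_vec (fst Q). snd Q x = snd Q' (U *\<^sub>v x)))"

definition represents :: "qform \<Rightarrow> int \<Rightarrow> bool" where
  "represents Q N \<longleftrightarrow> (\<exists>x \<in> carrier_vec (fst Q). snd Q x = N)"

definition prim_represents :: "qform \<Rightarrow> int \<Rightarrow> bool" where
  "prim_represents Q N \<longleftrightarrow>
     (\<exists>x \<in> carrier_vec (fst Q). Gcd ((\<lambda>i. x $ i) ` {..<fst Q}) = 1 \<and> snd Q x = N)"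

definition scale_form :: "int \<Rightarrow> qform \<Rightarrow> qform" where
  "scale_form c Q = (fst Q, \<lambda>x. c * snd Q x)"

text \<open>The form \<open>[a, b, c, r, s, t] = a x^2 + b y^2 + c z^2 + r y z + s x z + t x y\<close>.\<close>

definition ternary_form :: "int \<Rightarrow> int \<Rightarrow> int \<Rightarrow> int \<Rightarrow> int \<Rightarrow> int \<Rightarrow> qform" where
  "ternary_form a b c r s t = (3, \<lambda>v. let x = v $ 0; y = v $ 1; z = v $ 2 in
     a * x^2 + b * y^2 + c * z^2 + r * y * z + s * x * z + t * x * y)"

section \<open>Spaces with functions\<close>

text \<open>Varieties are handled through their Zariski topology and their sheaf of regular functions.
  \<open>reg X U\<close> is the set of functions that are regular on the open set \<open>U\<close>; the values outside
  \<open>U\<close> are arbitrary, so regular functions are to be compared on \<open>U\<close> only.\<close>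

record ('p, 'k) space =
  zar :: "'p topology"
  reg :: "'p set \<Rightarrow> ('p \<Rightarrow> 'k) set"

abbreviation points :: "('p, 'k) space \<Rightarrow> 'p set" where
  "points X \<equiv> topspace (zar X)"

definition morphism :: "('p, 'k) space \<Rightarrow> ('r, 'k) space \<Rightarrow> ('p \<Rightarrow> 'r) \<Rightarrow> bool" where
  "morphism X Y \<phi> \<longleftrightarrow> continuous_map (zar X) (zar Y) \<phi> \<and>
     (\<forall>U f. openin (zar Y) U \<and> f \<in> reg Y U \<longrightarrow> f \<circ> \<phi> \<in> reg X {x \<in> points X. \<phi> x \<in> U})"

definition isomorphism :: "('p, 'k) space \<Rightarrow> ('r, 'k) space \<Rightarrow> ('p \<Rightarrow> 'r) \<Rightarrow> bool" where
  "isomorphism X Y \<phi> \<longleftrightarrow> morphism X Y \<phi> \<and>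
     (\<exists>\<psi>. morphism Y X \<psi> \<and> (\<forall>x \<in> points X. \<psi> (\<phi> x) = x) \<and> (\<forall>y \<in> points Y. \<phi> (\<psi> y) = y))"

text \<open>The product of two varieties: on a product \<open>U \<times> V\<close> of open sets the functions
  \<open>\<Sum>\<^sub>i f\<^sub>i \<otimes> g\<^sub>i\<close> are regular; their non-vanishing loci form a basis of the Zariski topology
  (which is finer than the product topology), and regular functions are locally quotients of
  such sums.\<close>

definition tensor_functions ::
  "('p, 'k::field) space \<Rightarrow> ('r, 'k) space \<Rightarrow> 'p set \<Rightarrow> 'r set \<Rightarrow> ('p \<times> 'r \<Rightarrow> 'k) set" where
  "tensor_functions X Y U V = {\<lambda>(x, y). \<Sum>i<n. f i x * g i y | (n::nat) f g.
     (\<forall>i<n. f i \<in> reg X U) \<and> (\<forall>i<n. g i \<in> reg Y V)}"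

definition product_zariski ::
  "('p, 'k::field) space \<Rightarrow> ('r, 'k) space \<Rightarrow> ('p \<times> 'r) topology" where
  "product_zariski X Y = topology_generated_by {{z \<in> U \<times> V. h z \<noteq> 0} | U V h.
     openin (zar X) U \<and> openin (zar Y) V \<and> h \<in> tensor_functions X Y U V}"

definition product_space ::
  "('p, 'k::field) space \<Rightarrow> ('r, 'k) space \<Rightarrow> ('p \<times> 'r, 'k) space" where
  "product_space X Y = \<lparr>zar = product_zariski X Y,
     reg = (\<lambda>W. {f. \<forall>z \<in> W. \<exists>U V N. openin (zar X) U \<and> openin (zar Y) V \<and>
       openin (product_zariski X Y) N \<and> z \<in> N \<and> N \<subseteq> W \<inter> U \<times> V \<and>
       (\<exists>g \<in> tensor_functions X Y U V. \<exists>h \<in> tensor_functions X Y U V.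
          \<forall>w \<in> N. h w \<noteq> 0 \<and> f w = g w / h w)})\<rparr>"

definition irreducible_in :: "'p topology \<Rightarrow> 'p set \<Rightarrow> bool" where
  "irreducible_in T Z \<longleftrightarrow> Z \<noteq> {} \<and> Z \<subseteq> topspace T \<and>
     (\<forall>F G. closedin T F \<and> closedin T G \<and> Z \<subseteq> F \<union> G \<longrightarrow> Z \<subseteq> F \<or> Z \<subseteq> G)"

definition closed_irreducible :: "('p, 'k) space \<Rightarrow> 'p set \<Rightarrow> bool" where
  "closed_irreducible X Z \<longleftrightarrow> closedin (zar X) Z \<and> irreducible_in (zar X) Z"

definition krull_dim :: "('p, 'k) space \<Rightarrow> nat" where
  "krull_dim X = (GREATEST n. \<exists>Z :: nat \<Rightarrow> 'p set.
     (\<forall>i\<le>n. closed_irreducible X (Z i)) \<and> (\<forall>i<n. Z i \<subset> Z (Suc i)))"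

text \<open>The dimension of the quotient of \<open>V\<close> by a subspace \<open>W\<close>, for spaces of functions.\<close>

abbreviation fun_span :: "('p \<Rightarrow> 'k::field) set \<Rightarrow> ('p \<Rightarrow> 'k) set" where
  "fun_span \<equiv> module.span (\<lambda>c f x. c * f x)"

definition quot_dim :: "('p \<Rightarrow> 'k::field) set \<Rightarrow> ('p \<Rightarrow> 'k) set \<Rightarrow> nat" where
  "quot_dim V W = (LEAST n. \<exists>B. finite B \<and> card B = n \<and> B \<subseteq> V \<and> V \<subseteq> fun_span (B \<union> W))"

text \<open>Functions regular near \<open>P\<close>, and those among them vanishing on \<open>Z\<close> near \<open>P\<close>. Both contain all
  functions that vanish near \<open>P\<close>, so quotients by \<open>germ_ideal\<close> are quotients of the
  local ring at \<open>P\<close>.\<close>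

definition germs :: "('p, 'k::field) space \<Rightarrow> 'p \<Rightarrow> ('p \<Rightarrow> 'k) set" where
  "germs X P = {f. \<exists>U. openin (zar X) U \<and> P \<in> U \<and> f \<in> reg X U}"

definition germ_ideal :: "('p, 'k::field) space \<Rightarrow> 'p set \<Rightarrow> 'p \<Rightarrow> ('p \<Rightarrow> 'k) set" where
  "germ_ideal X Z P = {f. \<exists>U. openin (zar X) U \<and> P \<in> U \<and> f \<in> reg X U \<and> (\<forall>x \<in> U \<inter> Z. f x = 0)}"

text \<open>Equality of the dimension of the cotangent space with the dimension of \<open>X\<close>, for irreducible \<open>X\<close>.\<close>

definition smooth :: "('p, 'k::field) space \<Rightarrow> bool" where
  "smooth X \<longleftrightarrow> (\<forall>P \<in> points X. quot_dim (germ_ideal X {P} P)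
     (fun_span {f * g | f g. f \<in> germ_ideal X {P} P \<and> g \<in> germ_ideal X {P} P}) = krull_dim X)"

section \<open>Divisors on smooth varieties\<close>

type_synonym 'p divisor = "'p set \<Rightarrow>\<^sub>0 int"

definition prime_divisors :: "('p, 'k) space \<Rightarrow> 'p set set" where
  "prime_divisors X = {Z. closed_irreducible X Z \<and> Z \<noteq> points X \<and>
     (\<forall>Y. closed_irreducible X Y \<and> Z \<subseteq> Y \<longrightarrow> Y = Z \<or> Y = points X)}"

abbreviation div_group :: "('p, 'k) space \<Rightarrow> 'p divisor monoid" where
  "div_group X \<equiv> free_Abelian_group (prime_divisors X)"

abbreviation divisors :: "('p, 'k) space \<Rightarrow> 'p divisor set" where
  "divisors X \<equiv> carrier (div_group X)"

text \<open>\<open>\<pi>\<close> generates the ideal sheaf of \<open>Z\<close> on \<open>V\<close>.\<close>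

definition local_equation :: "('p, 'k::field) space \<Rightarrow> 'p set \<Rightarrow> 'p set \<Rightarrow> ('p \<Rightarrow> 'k) \<Rightarrow> bool" where
  "local_equation X Z V \<pi> \<longleftrightarrow> \<pi> \<in> reg X V \<and> {x \<in> V. \<pi> x = 0} = Z \<inter> V \<and>
     (\<forall>W g. openin (zar X) W \<and> W \<subseteq> V \<and> g \<in> reg X W \<and> (\<forall>x \<in> Z \<inter> W. g x = 0) \<longrightarrow>
        (\<exists>h \<in> reg X W. \<forall>x \<in> W. g x = h x * \<pi> x))"

text \<open>\<open>ord_along X Z f n\<close>: the rational function \<open>f\<close> has order \<open>n\<close> along the prime divisor \<open>Z\<close>,
  i.e. it agrees, on a nonempty open set, with \<open>u \<cdot> \<pi>\<^sup>n\<close>, where \<open>u\<close> is a unit and \<open>\<pi>\<close> is a local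
  equation of \<open>Z\<close> near the generic point of \<open>Z\<close>.\<close>

definition ord_along :: "('p, 'k::field) space \<Rightarrow> 'p set \<Rightarrow> ('p \<Rightarrow> 'k) \<Rightarrow> int \<Rightarrow> bool" where
  "ord_along X Z f n \<longleftrightarrow> (\<exists>V \<pi> u W. openin (zar X) V \<and> V \<inter> Z \<noteq> {} \<and> local_equation X Z V \<pi> \<and>
     u \<in> reg X V \<and> (\<forall>x \<in> V. u x \<noteq> 0) \<and>
     openin (zar X) W \<and> W \<noteq> {} \<and> W \<subseteq> V \<and> (\<forall>x \<in> W. f x = u x * \<pi> x powi n))"

definition rational_functions :: "('p, 'k::field) space \<Rightarrow> ('p \<Rightarrow> 'k) set" where
  "rational_functions X = {f. \<exists>U. openin (zar X) U \<and> U \<noteq> {} \<and> f \<in> reg X U}"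

definition generically_zero :: "('p, 'k::field) space \<Rightarrow> ('p \<Rightarrow> 'k) set" where
  "generically_zero X = {f. \<exists>U. openin (zar X) U \<and> U \<noteq> {} \<and> (\<forall>x \<in> U. f x = 0)}"

definition principal_divisors :: "('p, 'k::field) space \<Rightarrow> 'p divisor set" where
  "principal_divisors X = {D \<in> divisors X. \<exists>f \<in> rational_functions X - generically_zero X.
     \<forall>Z \<in> prime_divisors X. ord_along X Z f (Poly_Mapping.lookup D Z)}"

definition lin_equiv :: "('p, 'k::field) space \<Rightarrow> 'p divisor \<Rightarrow> 'p divisor \<Rightarrow> bool" where
  "lin_equiv X D E \<longleftrightarrow> D \<in> divisors X \<and> E \<in> divisors X \<and> D - E \<in> principal_divisors X"

definition lin_class :: "('p, 'k::field) space \<Rightarrow> 'p divisor \<Rightarrow> 'p divisor set" where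
  "lin_class X D = principal_divisors X #>\<^bsub>div_group X\<^esub> D"

text \<open>The transport of divisors along an isomorphism.\<close>

definition push_divisor :: "('p \<Rightarrow> 'r) \<Rightarrow> 'p divisor \<Rightarrow> 'r divisor" where
  "push_divisor \<phi> D = frag_extend (\<lambda>Z. frag_of (\<phi> ` Z)) D"

text \<open>The intersection number of divisors on a smooth projective surface: the local
  multiplicity of two curves at \<open>P\<close> is the dimension of \<open>O\<^sub>P\<close> modulo the sum of
  their ideals; divisors with common components are first moved in their linear
  equivalence classes.\<close>

definition local_mult :: "('p, 'k::field) space \<Rightarrow> 'p set \<Rightarrow> 'p set \<Rightarrow> 'p \<Rightarrow> nat" where
  "local_mult X Z Y P =
     quot_dim (germs X P) {f + g | f g. f \<in> germ_ideal X Z P \<and> g \<in> germ_ideal X Y P}"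

definition proper_intersection :: "('p, 'k::field) space \<Rightarrow> 'p divisor \<Rightarrow> 'p divisor \<Rightarrow> int" where
  "proper_intersection X D E = (\<Sum>Z \<in> Poly_Mapping.keys D. \<Sum>Y \<in> Poly_Mapping.keys E.
     Poly_Mapping.lookup D Z * Poly_Mapping.lookup E Y * (\<Sum>P \<in> Z \<inter> Y. int (local_mult X Z Y P)))"

definition intersection_number :: "('p, 'k::field) space \<Rightarrow> 'p divisor \<Rightarrow> 'p divisor \<Rightarrow> int" where
  "intersection_number X D E = (THE n. \<exists>D' E'. lin_equiv X D D' \<and> lin_equiv X E E' \<and>
     Poly_Mapping.keys D' \<inter> Poly_Mapping.keys E' = {} \<and> n = proper_intersection X D' E')"

section \<open>Projective varieties\<close>

text \<open>Polynomials in the variables \<open>x\<^sub>0, x\<^sub>1, \<dots>\<close>.\<close>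

type_synonym 'k mpoly = "(nat \<Rightarrow>\<^sub>0 nat) \<Rightarrow>\<^sub>0 'k"

definition eval_mpoly :: "'k::field mpoly \<Rightarrow> (nat \<Rightarrow> 'k) \<Rightarrow> 'k" where
  "eval_mpoly p v = (\<Sum>m \<in> Poly_Mapping.keys p. Poly_Mapping.lookup p m *
     (\<Prod>i \<in> Poly_Mapping.keys m. v i ^ Poly_Mapping.lookup m i))"

definition homogeneous :: "nat \<Rightarrow> 'k::field mpoly \<Rightarrow> bool" where
  "homogeneous d p \<longleftrightarrow> (\<forall>m \<in> Poly_Mapping.keys p.
     (\<Sum>i \<in> Poly_Mapping.keys m. Poly_Mapping.lookup m i) = d)"

text \<open>A point of projective space is the set of all its vectors of homogeneous coordinates,
  extended by zero; thus \<open>P\<^sup>n \<subseteq> P\<^sup>m\<close> for \<open>n \<le> m\<close>.\<close>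

type_synonym 'k pt = "(nat \<Rightarrow> 'k) set"

definition proj_space :: "nat \<Rightarrow> 'k::field pt set" where
  "proj_space n = {{\<lambda>i. c * v i | c. c \<noteq> 0} | v. (\<exists>i. v i \<noteq> 0) \<and> (\<forall>i>n. v i = 0)}"

text \<open>For homogeneous polynomials the vanishing of \<open>at_pt p P\<close>, and the quotient
  \<open>at_pt p P / at_pt q P\<close> for equal degrees, are independent of the chosen coordinates.\<close>

definition at_pt :: "'k::field mpoly \<Rightarrow> 'k pt \<Rightarrow> 'k" where
  "at_pt p P = eval_mpoly p (SOME v. v \<in> P)"

definition zariski :: "'k::field pt set \<Rightarrow> 'k pt topology" where
  "zariski X = topology_generated_by {{P \<in> X. at_pt p P \<noteq> 0} | p. \<exists>d. homogeneous d p}"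

definition var :: "'k::field pt set \<Rightarrow> ('k pt, 'k) space" where
  "var X = \<lparr>zar = zariski X,
     reg = (\<lambda>U. {f. \<forall>P \<in> U. \<exists>V d p q. openin (zariski X) V \<and> P \<in> V \<and> V \<subseteq> U \<and>
       homogeneous d p \<and> homogeneous d q \<and>
       (\<forall>Q \<in> V. at_pt q Q \<noteq> 0 \<and> f Q = at_pt p Q / at_pt q Q)})\<rparr>"

definition projective_variety :: "'k::field pt set \<Rightarrow> bool" where
  "projective_variety X \<longleftrightarrow> (\<exists>n. closedin (zariski (proj_space n)) X \<and>
     irreducible_in (zariski (proj_space n)) X)"

text \<open>The divisor on \<open>Y\<close> cut out by a linear form \<open>l\<close>; near the generic point of \<open>Z\<close> it is given
  by \<open>l / m\<close>, where \<open>m\<close> is a linear form not vanishing on \<open>Z\<close>.\<close>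

definition hyperplane_section :: "'k::field pt set \<Rightarrow> 'k pt divisor \<Rightarrow> bool" where
  "hyperplane_section Y E \<longleftrightarrow> E \<in> divisors (var Y) \<and>
     (\<exists>l. homogeneous 1 l \<and> (\<exists>P \<in> Y. at_pt l P \<noteq> 0) \<and>
       (\<forall>Z \<in> prime_divisors (var Y). \<exists>m. homogeneous 1 m \<and> (\<exists>P \<in> Z. at_pt m P \<noteq> 0) \<and>
          ord_along (var Y) Z (\<lambda>P. at_pt l P / at_pt m P) (Poly_Mapping.lookup E Z)))"

definition very_ample :: "'k::field pt set \<Rightarrow> 'k pt divisor \<Rightarrow> bool" where
  "very_ample X D \<longleftrightarrow> (\<exists>Y \<phi> E. projective_variety Y \<and> isomorphism (var X) (var Y) \<phi> \<and>
     hyperplane_section Y E \<and> lin_equiv (var Y) (push_divisor \<phi> D) E)"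

definition ample :: "'k::field pt set \<Rightarrow> 'k pt divisor \<Rightarrow> bool" where
  "ample X D \<longleftrightarrow> (\<exists>n>0. very_ample X (frag_cmul n D))"

section \<open>Curves\<close>

definition smooth_curve :: "'k::field pt set \<Rightarrow> bool" where
  "smooth_curve C \<longleftrightarrow> projective_variety C \<and> krull_dim (var C) = 1 \<and> smooth (var C)"

definition degree_div :: "'p divisor \<Rightarrow> int" where
  "degree_div D = (\<Sum>Z \<in> Poly_Mapping.keys D. Poly_Mapping.lookup D Z)"

definition riemann_roch_space :: "('p, 'k::field) space \<Rightarrow> 'p divisor \<Rightarrow> ('p \<Rightarrow> 'k) set" where
  "riemann_roch_space X D = {f \<in> rational_functions X. f \<in> generically_zero X \<or>
     (\<forall>Z \<in> prime_divisors X. \<exists>n. ord_along X Z f n \<and> n \<ge> - Poly_Mapping.lookup D Z)}"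

definition ell :: "('p, 'k::field) space \<Rightarrow> 'p divisor \<Rightarrow> nat" where
  "ell X D = quot_dim (riemann_roch_space X D) (riemann_roch_space X D \<inter> generically_zero X)"

text \<open>The genus as defined by Riemann's inequality: the maximum of \<open>deg D - \<ell>(D) + 1\<close>.\<close>

definition genus :: "'k::field pt set \<Rightarrow> int" where
  "genus C = (GREATEST g. \<exists>D \<in> divisors (var C). g = degree_div D - int (ell (var C) D) + 1)"

section \<open>Principally polarized abelian surfaces\<close>

text \<open>An abelian variety is given by its group of points, whose carrier is a projective variety.\<close>

abbreviation avar :: "'k::field pt monoid \<Rightarrow> ('k pt, 'k) space" where
  "avar A \<equiv> var (carrier A)"

definition abelian_variety :: "'k::field pt monoid \<Rightarrow> bool" where
  "abelian_variety A \<longleftrightarrow> Group.group A \<and> projective_variety (carrier A) \<and>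
     morphism (product_space (avar A) (avar A)) (avar A) (\<lambda>(x, y). x \<otimes>\<^bsub>A\<^esub> y) \<and>
     morphism (avar A) (avar A) (\<lambda>x. inv\<^bsub>A\<^esub> x)"

text \<open>The pullback of \<open>D\<close> along the translation \<open>x \<mapsto> a \<otimes> x\<close>.\<close>

definition translate_pullback :: "'k::field pt monoid \<Rightarrow> 'k pt \<Rightarrow> 'k pt divisor \<Rightarrow> 'k pt divisor" where
  "translate_pullback A a D = push_divisor (\<lambda>x. inv\<^bsub>A\<^esub> a \<otimes>\<^bsub>A\<^esub> x) D"

text \<open>The divisors whose class is in \<open>Pic\<^sup>0(A)\<close>, i.e. is translation invariant (Mumford); these are
  the divisors algebraically equivalent to zero.\<close>

definition pic0_divisors :: "'k::field pt monoid \<Rightarrow> 'k pt divisor set" where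
  "pic0_divisors A = {D \<in> divisors (avar A).
     \<forall>a \<in> carrier A. lin_equiv (avar A) (translate_pullback A a D) D}"

definition NS :: "'k::field pt monoid \<Rightarrow> 'k pt divisor set monoid" where
  "NS A = div_group (avar A) Mod pic0_divisors A"

definition ns_class :: "'k::field pt monoid \<Rightarrow> 'k pt divisor \<Rightarrow> 'k pt divisor set" where
  "ns_class A D = pic0_divisors A #>\<^bsub>div_group (avar A)\<^esub> D"

text \<open>\<open>\<theta>\<close> is the class of an ample \<open>D\<close> for which \<open>a \<mapsto> t\<^sub>a\<^sup>*D - D\<close> is an isomorphism from \<open>A\<close> to the
  dual abelian variety \<open>Pic\<^sup>0(A)\<close>; in characteristic \<open>0\<close> a homomorphism of abelian varieties that is
  bijective on points is an isomorphism.\<close>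

definition principal_polarization :: "'k::field pt monoid \<Rightarrow> 'k pt divisor set \<Rightarrow> bool" where
  "principal_polarization A \<theta> \<longleftrightarrow> (\<exists>D \<in> divisors (avar A). \<theta> = ns_class A D \<and> ample (carrier A) D \<and>
     bij_betw (\<lambda>a. lin_class (avar A) (translate_pullback A a D - D)) (carrier A)
       (lin_class (avar A) ` pic0_divisors A))"

definition ppas :: "'k::field pt monoid \<Rightarrow> 'k pt divisor set \<Rightarrow> bool" where
  "ppas A \<theta> \<longleftrightarrow> abelian_variety A \<and> krull_dim (avar A) = 2 \<and> principal_polarization A \<theta>"

definition ppas_iso :: "(('k::field pt monoid \<times> 'k pt divisor set) \<times> ('k pt monoid \<times> 'k pt divisor set)) set" where
  "ppas_iso = {((A, \<theta>), (B, \<eta>)). ppas A \<theta> \<and> ppas B \<eta> \<and>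
     (\<exists>\<phi>. isomorphism (avar A) (avar B) \<phi> \<and> \<phi> \<in> hom A B \<and> push_divisor \<phi> ` \<theta> = \<eta>)}"

text \<open>The points of the moduli space \<open>A\<^sub>2\<close> are the isomorphism classes.\<close>

type_synonym 'k moduli_pt = "('k pt monoid \<times> 'k pt divisor set) set"

definition moduli_class :: "'k::field pt monoid \<Rightarrow> 'k pt divisor set \<Rightarrow> 'k moduli_pt" where
  "moduli_class A \<theta> = ppas_iso `` {(A, \<theta>)}"

definition moduli_A2 :: "'k::field moduli_pt set" where
  "moduli_A2 = {(A, \<theta>). ppas A \<theta>} // ppas_iso"

section \<open>The refined Humbert invariant and Humbert surfaces\<close>

definition ns_intersection ::
  "'k::field pt monoid \<Rightarrow> 'k pt divisor set \<Rightarrow> 'k pt divisor set \<Rightarrow> int" where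
  "ns_intersection A c d = the_elem {intersection_number (avar A) D E | D E. D \<in> c \<and> E \<in> d}"

definition q_tilde :: "'k::field pt monoid \<Rightarrow> 'k pt divisor set \<Rightarrow> 'k pt divisor set \<Rightarrow> int" where
  "q_tilde A \<theta> c = (ns_intersection A c \<theta>)\<^sup>2 - 2 * ns_intersection A c c"

definition NS_mod_theta :: "'k::field pt monoid \<Rightarrow> 'k pt divisor set \<Rightarrow> 'k pt divisor set set monoid" where
  "NS_mod_theta A \<theta> = NS A Mod generate (NS A) {\<theta>}"

definition q_induced :: "'k::field pt monoid \<Rightarrow> 'k pt divisor set \<Rightarrow> 'k pt divisor set set \<Rightarrow> int" where
  "q_induced A \<theta> c = the_elem (q_tilde A \<theta> ` c)"

definition int_comb :: "('a, 'b) monoid_scheme \<Rightarrow> nat \<Rightarrow> (nat \<Rightarrow> 'a) \<Rightarrow> int vec \<Rightarrow> 'a" where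
  "int_comb G n b x = finprod G (\<lambda>i. b i [^]\<^bsub>G\<^esub> (x $ i)) {..<n}"

definition z_basis :: "('a, 'b) monoid_scheme \<Rightarrow> nat \<Rightarrow> (nat \<Rightarrow> 'a) \<Rightarrow> bool" where
  "z_basis G n b \<longleftrightarrow> (\<forall>i<n. b i \<in> carrier G) \<and>
     (\<forall>g \<in> carrier G. \<exists>!x. x \<in> carrier_vec n \<and> g = int_comb G n b x)"

text \<open>The equivalence class of integral quadratic forms given by the induced form.\<close>

definition refined_humbert :: "'k::field pt monoid \<Rightarrow> 'k pt divisor set \<Rightarrow> qform set" where
  "refined_humbert A \<theta> = {Q. integral_form Q \<and> (\<exists>n b. z_basis (NS_mod_theta A \<theta>) n b \<and>
     Q \<sim>\<^sub>Z (n, \<lambda>x. q_induced A \<theta> (int_comb (NS_mod_theta A \<theta>) n b x)))}"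

definition humbert_surface :: "nat \<Rightarrow> 'k::field moduli_pt set" where
  "humbert_surface N = {c \<in> moduli_A2. \<exists>A \<theta>. c = moduli_class A \<theta> \<and> ppas A \<theta> \<and>
     (\<exists>Q \<in> refined_humbert A \<theta>. prim_represents Q (int N))}"

definition humbert_infinity :: "'k::field moduli_pt set" where
  "humbert_infinity = (\<Inter>N \<in> {N. N > 0 \<and> odd N \<and> squarefree N}. humbert_surface (4 * N))"

section \<open>Jacobians of curves of genus 2\<close>

definition div0 :: "'k::field pt set \<Rightarrow> 'k pt divisor set" where
  "div0 C = {D \<in> divisors (var C). degree_div D = 0}"

text \<open>The extension of \<open>j\<close> to divisors; a prime divisor on a curve is a singleton.\<close>

definition div_sum :: "'k::field pt monoid \<Rightarrow> ('k pt \<Rightarrow> 'k pt) \<Rightarrow> 'k pt divisor \<Rightarrow> 'k pt" where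
  "div_sum J j D = finprod J (\<lambda>Z. j (the_elem Z) [^]\<^bsub>J\<^esub> Poly_Mapping.lookup D Z) (Poly_Mapping.keys D)"

text \<open>\<open>J\<close> is the Jacobian of \<open>C\<close>: there is a morphism \<open>j\<close> from \<open>C\<close> to \<open>J\<close> whose extension to divisors of
  degree \<open>0\<close> induces an isomorphism from \<open>Pic\<^sup>0(C)\<close> to \<open>J\<close>. This determines \<open>J\<close>, and \<open>j\<close> up to
  translation, in characteristic \<open>0\<close>. For genus 2 the theta divisor is the curve \<open>j(C)\<close>; that its class is a
  principal polarization is part of the definition of the polarized Jacobian.\<close>

definition polarized_jacobian :: "'k::field pt set \<Rightarrow> 'k pt monoid \<Rightarrow> 'k pt divisor set \<Rightarrow> bool" where
  "polarized_jacobian C J \<theta> \<longleftrightarrow> ppas J \<theta> \<and>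
     (\<exists>j. morphism (var C) (avar J) j \<and>
        div_sum J j ` div0 C = carrier J \<and>
        (\<forall>D \<in> div0 C. div_sum J j D = \<one>\<^bsub>J\<^esub> \<longleftrightarrow> D \<in> principal_divisors (var C)) \<and>
        \<theta> = ns_class J (frag_of (j ` C)))"

end

theory Submission
  imports Defs
begin

text \<open>A square-free value of a form is represented primitively, so if \<open>f'\<close> represents all odd positive
  integers, then \<open>4f'\<close> primitively represents all \<open>4N\<close> with \<open>N\<close> odd and square-free. Conversely, membership in
  \<open>H\<^sub>4\<^sub>N\<close> only provides a surface \<open>(A, \<eta>)\<close> isomorphic to \<open>(J, \<theta>)\<close> and an element of its group \<open>NS/\<int>\<eta>\<close>
  with value \<open>4N\<close>; everything entering the refined Humbert invariant is transported along the
  isomorphism, so \<open>4f'\<close> represents \<open>4N\<close>, and a general odd number is a square-free one times a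
  square. The values of the transported data agree even where an intersection number is a junk value,
  so that no intersection theory is needed; but \<open>NS/\<int>\<eta>\<close> must be a group, which rests on
  \<open>pic0_divisors\<close> being a subgroup.\<close>

subsection \<open>Regular functions on projective varieties\<close>

text \<open>Whether a form in \<open>refined_humbert\<close> represents a number depends only on the
  set of values of \<open>q_induced\<close> on NS/Z\<theta>. Bases merely name elements there, so
  two of them never have to be matched; it is enough that each value on one surface is a value on
  the other. All ingredients of such a value (prime divisors, orders, principal divisors, germs,
  local multiplicities) are built from open sets and regular functions, so an isomorphism carries
  them along. Typically one implication or inequality is proved and the other is read off from the
  inverse map. The genuine geometry lies in the closure of principal divisors under differences:
  \<open>f\<close> and \<open>g\<close> have orders with respect to different local equations, and
  \<open>f / g\<close> gets an order once these are known to differ by a unit, which rests on the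
  density of nonempty open sets, that is, on irreducibility. The indices of
  \<open>humbert_infinity\<close> are square-free because for such numbers representing and
  primitively representing coincide, while for other odd numbers they may differ.\<close>

definition eval_monomial :: "(nat \<Rightarrow> 'k::field) \<Rightarrow> (nat \<Rightarrow>\<^sub>0 nat) \<Rightarrow> 'k" where
  "eval_monomial v m = (\<Prod>i \<in> Poly_Mapping.keys m. v i ^ Poly_Mapping.lookup m i)"

text \<open>The added factors have exponent 0. One finite index set for \<open>m\<close>,
  \<open>n\<close> and \<open>m + n\<close> turns multiplicativity of evaluation into a factorwise
  identity.\<close>

lemma eval_monomial_superset:
  assumes "finite S" "Poly_Mapping.keys m \<subseteq> S"
  shows "eval_monomial v m = (\<Prod>i\<in>S. v i ^ Poly_Mapping.lookup m i)"
  unfolding eval_monomial_def using assms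
  by (intro prod.mono_neutral_left) (auto simp: in_keys_iff)

lemma eval_monomial_add: "eval_monomial v (m + n) = eval_monomial v m * eval_monomial v n"
proof -
  let ?S = "Poly_Mapping.keys m \<union> Poly_Mapping.keys n"
  have "Poly_Mapping.keys (m + n) \<subseteq> ?S" by (rule keys_add)
  then show ?thesis
    using eval_monomial_superset[of ?S _ v]
    by (simp add: lookup_add power_add prod.distrib)
qed

lemma eval_mpoly_alt:
  "eval_mpoly p v = (\<Sum>m \<in> Poly_Mapping.keys p. Poly_Mapping.lookup p m * eval_monomial v m)"
  by (simp add: eval_mpoly_def eval_monomial_def)

lemma eval_mpoly_add: "eval_mpoly (p + q) v = eval_mpoly p v + eval_mpoly q v"
  unfolding eval_mpoly_alt
  by (rule setsum_keys_plus_distrib[where f = "\<lambda>m c. c * eval_monomial v m"])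
     (auto simp: algebra_simps)

lemma eval_mpoly_single: "eval_mpoly (Poly_Mapping.single m c) v = c * eval_monomial v m"
  by (cases "c = 0") (auto simp: eval_mpoly_alt)

lemma eval_mpoly_sum: "eval_mpoly (\<Sum>i\<in>I. p i) v = (\<Sum>i\<in>I. eval_mpoly (p i) v)"
  by (induction I rule: infinite_finite_induct) (auto simp: eval_mpoly_add, auto simp: eval_mpoly_def)

text \<open>Expanding both factors of \<open>p * q\<close> in this way reduces multiplicativity of
  evaluation to the case of two monomials.\<close>

lemma poly_mapping_sum_singles:
  fixes p :: "'a \<Rightarrow>\<^sub>0 'b::comm_monoid_add"
  shows "(\<Sum>m\<in>Poly_Mapping.keys p. Poly_Mapping.single m (Poly_Mapping.lookup p m)) = p"
  by (rule poly_mapping_eqI) (auto simp: lookup_sum lookup_single when_def in_keys_iff)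

lemma eval_mpoly_mult: "eval_mpoly (p * q) v = eval_mpoly p v * eval_mpoly q v"
proof -
  have "p * q = (\<Sum>m\<in>Poly_Mapping.keys p. \<Sum>n\<in>Poly_Mapping.keys q.
      Poly_Mapping.single (m + n) (Poly_Mapping.lookup p m * Poly_Mapping.lookup q n))"
    by (subst (1 2) poly_mapping_sum_singles[symmetric])
       (simp add: sum_product mult_single)
  then have "eval_mpoly (p * q) v = (\<Sum>m\<in>Poly_Mapping.keys p. \<Sum>n\<in>Poly_Mapping.keys q.
      (Poly_Mapping.lookup p m * eval_monomial v m) * (Poly_Mapping.lookup q n * eval_monomial v n))"
    by (simp add: eval_mpoly_sum eval_mpoly_single eval_monomial_add mult_ac)
  then show ?thesis
    by (simp add: eval_mpoly_alt sum_product)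
qed

lemma eval_mpoly_diff: "eval_mpoly (p - q) v = eval_mpoly p v - eval_mpoly q v"
  using eval_mpoly_add[of "p - q" q v] by simp

text \<open>\<open>at_pt\<close> picks its coordinate vector from the point alone, so all
  polynomials are evaluated at one and the same vector, and evaluation at a point respects the ring
  operations.\<close>

lemma at_pt_mult: "at_pt (p * q) P = at_pt p P * at_pt q P"
  by (simp add: at_pt_def eval_mpoly_mult)

lemma at_pt_diff: "at_pt (p - q) P = at_pt p P - at_pt q P"
  by (simp add: at_pt_def eval_mpoly_diff)

lemma at_pt_const: "at_pt (Poly_Mapping.single 0 c) P = c"
  by (simp add: at_pt_def eval_mpoly_single eval_monomial_def)

lemma at_pt_one [simp]: "at_pt 1 P = 1"
  using at_pt_const[of 1 P] by simp

lemma homogeneous_const: "homogeneous 0 (Poly_Mapping.single 0 c)"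
  by (auto simp: homogeneous_def)

definition monomial_degree :: "(nat \<Rightarrow>\<^sub>0 nat) \<Rightarrow> nat" where
  "monomial_degree m = (\<Sum>i \<in> Poly_Mapping.keys m. Poly_Mapping.lookup m i)"

lemma monomial_degree_add: "monomial_degree (m + n) = monomial_degree m + monomial_degree n"
  unfolding monomial_degree_def
  by (rule setsum_keys_plus_distrib[where f = "\<lambda>_ c. c"]) auto

lemma homogeneous_iff_monomial_degree:
  "homogeneous d p \<longleftrightarrow> (\<forall>m \<in> Poly_Mapping.keys p. monomial_degree m = d)"
  by (simp add: homogeneous_def monomial_degree_def)

lemma homogeneous_mult:
  assumes "homogeneous d p" "homogeneous e q"
  shows "homogeneous (d + e) (p * q)"
  unfolding homogeneous_iff_monomial_degree
proof
  fix m assume "m \<in> Poly_Mapping.keys (p * q)"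
  then obtain a b where "m = a + b" "a \<in> Poly_Mapping.keys p" "b \<in> Poly_Mapping.keys q"
    using keys_mult[of p q] by blast
  then show "monomial_degree m = d + e"
    using assms by (simp add: homogeneous_iff_monomial_degree monomial_degree_add)
qed

lemma homogeneous_diff:
  assumes "homogeneous d p" "homogeneous d q"
  shows "homogeneous d (p - q)"
  unfolding homogeneous_iff_monomial_degree
proof
  fix m assume "m \<in> Poly_Mapping.keys (p - q)"
  then have "m \<in> Poly_Mapping.keys p \<or> m \<in> Poly_Mapping.keys q"
    by (auto simp: in_keys_iff lookup_minus)
  then show "monomial_degree m = d"
    using assms by (auto simp: homogeneous_iff_monomial_degree)
qed

section \<open>Rings of regular functions\<close>

text \<open>What the arguments on divisors use of regular functions, so that they can ignore
  polynomials. \<open>reg_cong\<close> expresses that values outside \<open>U\<close> are arbitrary;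
  \<open>openin_nonzero\<close> is the continuity that makes zero sets of regular functions closed
  in \<open>U\<close>.\<close>

locale function_space =
  fixes X :: "('p, 'k::field) space"
  assumes reg_cong: "\<And>f g U. f \<in> reg X U \<Longrightarrow> (\<And>x. x \<in> U \<Longrightarrow> f x = g x) \<Longrightarrow> g \<in> reg X U"
    and reg_restrict: "\<And>f U V. f \<in> reg X U \<Longrightarrow> openin (zar X) V \<Longrightarrow> V \<subseteq> U \<Longrightarrow> f \<in> reg X V"
    and reg_const: "\<And>U c. openin (zar X) U \<Longrightarrow> (\<lambda>_. c) \<in> reg X U"
    and reg_diff: "\<And>f g U. f \<in> reg X U \<Longrightarrow> g \<in> reg X U \<Longrightarrow> (\<lambda>x. f x - g x) \<in> reg X U"
    and reg_mult: "\<And>f g U. f \<in> reg X U \<Longrightarrow> g \<in> reg X U \<Longrightarrow> (\<lambda>x. f x * g x) \<in> reg X U"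
    and reg_inverse: "\<And>f U. f \<in> reg X U \<Longrightarrow> (\<And>x. x \<in> U \<Longrightarrow> f x \<noteq> 0) \<Longrightarrow> (\<lambda>x. inverse (f x)) \<in> reg X U"
    and openin_nonzero: "\<And>f U. f \<in> reg X U \<Longrightarrow> openin (zar X) {x \<in> U. f x \<noteq> 0}"

lemma reg_varI:
  assumes "\<And>P. P \<in> U \<Longrightarrow> \<exists>V d p q. openin (zariski X) V \<and> P \<in> V \<and> V \<subseteq> U \<and>
       homogeneous d p \<and> homogeneous d q \<and>
       (\<forall>Q \<in> V. at_pt q Q \<noteq> 0 \<and> f Q = at_pt p Q / at_pt q Q)"
  shows "f \<in> reg (var X) U"
  using assms by (auto simp: var_def)

lemma reg_varE:
  assumes "f \<in> reg (var X) U" "P \<in> U"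
  obtains V d p q where "openin (zariski X) V" "P \<in> V" "V \<subseteq> U"
    "homogeneous d p" "homogeneous d q" "\<And>Q. Q \<in> V \<Longrightarrow> at_pt q Q \<noteq> 0"
    "\<And>Q. Q \<in> V \<Longrightarrow> f Q = at_pt p Q / at_pt q Q"
proof -
  have "\<exists>V d p q. openin (zariski X) V \<and> P \<in> V \<and> V \<subseteq> U \<and>
       homogeneous d p \<and> homogeneous d q \<and>
       (\<forall>Q \<in> V. at_pt q Q \<noteq> 0 \<and> f Q = at_pt p Q / at_pt q Q)"
    using assms by (simp add: var_def)
  then show ?thesis using that by blast
qed

lemma openin_zariski_nonzero:
  "homogeneous d p \<Longrightarrow> openin (zariski X) {P \<in> X. at_pt p P \<noteq> 0}"
  unfolding zariski_def by (rule topology_generated_by_Basis) blast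

lemma topspace_zariski: "topspace (zariski X) = X"
proof -
  \<comment> \<open>The constant polynomial \<open>1\<close> vanishes nowhere, so \<open>X\<close>
    is itself one of the generators.\<close>
  have "X \<in> {{P \<in> X. at_pt p P \<noteq> 0} | p. \<exists>d. homogeneous d p}"
    by (rule CollectI, rule exI[of _ "Poly_Mapping.single 0 1"])
       (use homogeneous_const[of 1] in \<open>auto simp: at_pt_const\<close>)
  then show ?thesis
    unfolding zariski_def topology_generated_by_topspace by auto
qed

lemma zar_var: "zar (var X) = zariski X"
  by (simp add: var_def)

lemma points_var [simp]: "points (var X) = X"
  by (simp add: zar_var topspace_zariski)

lemma function_space_var: "function_space (var X)"
proof
  fix f g U assume f: "f \<in> reg (var X) U" and fg: "\<And>x. x \<in> U \<Longrightarrow> f x = g x"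
  show "g \<in> reg (var X) U"
  proof (rule reg_varI)
    fix P assume "P \<in> U"
    from reg_varE[OF f this] obtain V d p q where V: "openin (zariski X) V" "P \<in> V" "V \<subseteq> U"
      "homogeneous d p" "homogeneous d q" "\<And>Q. Q \<in> V \<Longrightarrow> at_pt q Q \<noteq> 0"
      "\<And>Q. Q \<in> V \<Longrightarrow> f Q = at_pt p Q / at_pt q Q" by metis
    moreover have "f Q = g Q" if "Q \<in> V" for Q using fg V(3) that by blast
    ultimately show "\<exists>V d p q. openin (zariski X) V \<and> P \<in> V \<and> V \<subseteq> U \<and>
       homogeneous d p \<and> homogeneous d q \<and> (\<forall>Q \<in> V. at_pt q Q \<noteq> 0 \<and> g Q = at_pt p Q / at_pt q Q)"
      by metis
  qed
next
  fix f U V assume f: "f \<in> reg (var X) U" and W: "openin (zar (var X)) V" "V \<subseteq> U"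
  then have W': "openin (zariski X) V" by (simp add: var_def)
  show "f \<in> reg (var X) V"
  proof (rule reg_varI)
    fix P assume P: "P \<in> V"
    with W have "P \<in> U" by blast
    from reg_varE[OF f this] obtain V' d p q where V: "openin (zariski X) V'" "P \<in> V'" "V' \<subseteq> U"
      "homogeneous d p" "homogeneous d q" "\<And>Q. Q \<in> V' \<Longrightarrow> at_pt q Q \<noteq> 0"
      "\<And>Q. Q \<in> V' \<Longrightarrow> f Q = at_pt p Q / at_pt q Q" by metis
    show "\<exists>V' d p q. openin (zariski X) V' \<and> P \<in> V' \<and> V' \<subseteq> V \<and>
       homogeneous d p \<and> homogeneous d q \<and> (\<forall>Q \<in> V'. at_pt q Q \<noteq> 0 \<and> f Q = at_pt p Q / at_pt q Q)"
      by (rule exI[of _ "V \<inter> V'"], rule exI[of _ d], rule exI[of _ p], rule exI[of _ q])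
         (use V P W' in auto)
  qed
next
  fix U and c :: 'a assume "openin (zar (var X)) U"
  then have U: "openin (zariski X) U" by (simp add: var_def)
  show "(\<lambda>_. c) \<in> reg (var X) U"
  proof (rule reg_varI)
    fix P assume P: "P \<in> U"
    show "\<exists>V d p q. openin (zariski X) V \<and> P \<in> V \<and> V \<subseteq> U \<and>
       homogeneous d p \<and> homogeneous d q \<and> (\<forall>Q \<in> V. at_pt q Q \<noteq> 0 \<and> c = at_pt p Q / at_pt q Q)"
      by (rule exI[of _ U], rule exI[of _ 0], rule exI[of _ "Poly_Mapping.single 0 c"],
          rule exI[of _ "Poly_Mapping.single 0 1"])
         (use U P homogeneous_const[of 1] homogeneous_const[of c] in \<open>auto simp: at_pt_const\<close>)
  qed
next
  fix f g U assume f: "f \<in> reg (var X) U" and g: "g \<in> reg (var X) U"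
  \<comment> \<open>One neighbourhood on which \<open>f\<close> and \<open>g\<close> are both
    quotients; the difference and the product then share the denominator
    \<open>q * s\<close>.\<close>
  have *: "\<exists>V d p q e r s. openin (zariski X) V \<and> P \<in> V \<and> V \<subseteq> U \<and>
       homogeneous d p \<and> homogeneous d q \<and> homogeneous e r \<and> homogeneous e s \<and>
       (\<forall>Q \<in> V. at_pt q Q \<noteq> 0 \<and> f Q = at_pt p Q / at_pt q Q \<and>
          at_pt s Q \<noteq> 0 \<and> g Q = at_pt r Q / at_pt s Q)" if P: "P \<in> U" for P
  proof -
    from reg_varE[OF f P] obtain V d p q where V: "openin (zariski X) V" "P \<in> V" "V \<subseteq> U"
      "homogeneous d p" "homogeneous d q" "\<And>Q. Q \<in> V \<Longrightarrow> at_pt q Q \<noteq> 0"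
      "\<And>Q. Q \<in> V \<Longrightarrow> f Q = at_pt p Q / at_pt q Q" by metis
    from reg_varE[OF g P] obtain W e r s where W: "openin (zariski X) W" "P \<in> W" "W \<subseteq> U"
      "homogeneous e r" "homogeneous e s" "\<And>Q. Q \<in> W \<Longrightarrow> at_pt s Q \<noteq> 0"
      "\<And>Q. Q \<in> W \<Longrightarrow> g Q = at_pt r Q / at_pt s Q" by metis
    show ?thesis
      by (rule exI[of _ "V \<inter> W"], rule exI[of _ d], rule exI[of _ p], rule exI[of _ q],
          rule exI[of _ e], rule exI[of _ r], rule exI[of _ s])
         (use V W in auto)
  qed
  show "(\<lambda>x. f x - g x) \<in> reg (var X) U"
  proof (rule reg_varI)
    fix P assume P: "P \<in> U"
    from *[OF P] obtain V d p q e r s where V: "openin (zariski X) V" "P \<in> V" "V \<subseteq> U"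
      "homogeneous d p" "homogeneous d q" "homogeneous e r" "homogeneous e s"
      "\<forall>Q \<in> V. at_pt q Q \<noteq> 0 \<and> f Q = at_pt p Q / at_pt q Q \<and>
          at_pt s Q \<noteq> 0 \<and> g Q = at_pt r Q / at_pt s Q" by metis
    \<comment> \<open>Both cross products have degree \<open>d + e\<close>, so the numerator is
      homogeneous of the same degree as the denominator.\<close>
    have "homogeneous (d + e) (p * s - r * q)"
      using homogeneous_mult[OF V(4,7)] homogeneous_mult[OF V(6,5)]
      by (simp add: homogeneous_diff add.commute)
    moreover note homogeneous_mult[OF V(5,7)]
    ultimately show "\<exists>V d p q. openin (zariski X) V \<and> P \<in> V \<and> V \<subseteq> U \<and>
       homogeneous d p \<and> homogeneous d q \<and>
       (\<forall>Q \<in> V. at_pt q Q \<noteq> 0 \<and> f Q - g Q = at_pt p Q / at_pt q Q)"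
      using V by (intro exI[of _ V] exI[of _ "d + e"] exI[of _ "p * s - r * q"] exI[of _ "q * s"])
         (auto simp: at_pt_mult at_pt_diff diff_frac_eq)
  qed
  show "(\<lambda>x. f x * g x) \<in> reg (var X) U"
  proof (rule reg_varI)
    fix P assume P: "P \<in> U"
    from *[OF P] obtain V d p q e r s where V: "openin (zariski X) V" "P \<in> V" "V \<subseteq> U"
      "homogeneous d p" "homogeneous d q" "homogeneous e r" "homogeneous e s"
      "\<forall>Q \<in> V. at_pt q Q \<noteq> 0 \<and> f Q = at_pt p Q / at_pt q Q \<and>
          at_pt s Q \<noteq> 0 \<and> g Q = at_pt r Q / at_pt s Q" by metis
    note homogeneous_mult[OF V(4,6)] homogeneous_mult[OF V(5,7)]
    then show "\<exists>V d p q. openin (zariski X) V \<and> P \<in> V \<and> V \<subseteq> U \<and>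
       homogeneous d p \<and> homogeneous d q \<and>
       (\<forall>Q \<in> V. at_pt q Q \<noteq> 0 \<and> f Q * g Q = at_pt p Q / at_pt q Q)"
      using V by (intro exI[of _ V] exI[of _ "d + e"] exI[of _ "p * r"] exI[of _ "q * s"])
         (auto simp: at_pt_mult)
  qed
next
  fix f U assume f: "f \<in> reg (var X) U" and nz: "\<And>x. x \<in> U \<Longrightarrow> f x \<noteq> 0"
  show "(\<lambda>x. inverse (f x)) \<in> reg (var X) U"
  proof (rule reg_varI)
    fix P assume "P \<in> U"
    from reg_varE[OF f this] obtain V d p q where V: "openin (zariski X) V" "P \<in> V" "V \<subseteq> U"
      "homogeneous d p" "homogeneous d q" "\<And>Q. Q \<in> V \<Longrightarrow> at_pt q Q \<noteq> 0"
      "\<And>Q. Q \<in> V \<Longrightarrow> f Q = at_pt p Q / at_pt q Q" by metis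
    moreover have "at_pt p Q \<noteq> 0" if "Q \<in> V" for Q using nz[of Q] V that by auto
    ultimately show "\<exists>V d p q. openin (zariski X) V \<and> P \<in> V \<and> V \<subseteq> U \<and>
       homogeneous d p \<and> homogeneous d q \<and>
       (\<forall>Q \<in> V. at_pt q Q \<noteq> 0 \<and> inverse (f Q) = at_pt p Q / at_pt q Q)"
      by (intro exI[of _ V] exI[of _ d] exI[of _ q] exI[of _ p]) auto
  qed
next
  fix f U assume f: "f \<in> reg (var X) U"
  have "openin (zariski X) {x \<in> U. f x \<noteq> 0}"
  proof (subst openin_subopen, safe)
    fix P assume P: "P \<in> U" "f P \<noteq> 0"
    from reg_varE[OF f P(1)] obtain V d p q where V: "openin (zariski X) V" "P \<in> V" "V \<subseteq> U"
      "homogeneous d p" "homogeneous d q" "\<And>Q. Q \<in> V \<Longrightarrow> at_pt q Q \<noteq> 0"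
      "\<And>Q. Q \<in> V \<Longrightarrow> f Q = at_pt p Q / at_pt q Q" by metis
    \<comment> \<open>Near \<open>P\<close> the zeros of \<open>f\<close> are those of its numerator
      \<open>p\<close>, so removing them leaves a neighbourhood of \<open>P\<close> on which
      \<open>f\<close> does not vanish.\<close>
    have "V \<subseteq> X" using openin_subset[OF V(1)] by (simp add: topspace_zariski)
    then show "\<exists>T. openin (zariski X) T \<and> P \<in> T \<and> T \<subseteq> {x \<in> U. f x \<noteq> 0}"
      using V P openin_Int[OF V(1) openin_zariski_nonzero[OF V(4)]]
      by (intro exI[of _ "V \<inter> {P \<in> X. at_pt p P \<noteq> 0}"]) auto
  qed
  then show "openin (zar (var X)) {x \<in> U. f x \<noteq> 0}" by (simp add: var_def)
qed

section \<open>Irreducibility and density of open sets\<close>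

text \<open>\<open>var X\<close> carries its own generated topology, whereas
  \<open>projective_variety\<close> asks for irreducibility inside projective space. The two are
  compared here: one polynomial defines corresponding generators, and traces on \<open>X\<close>
  commute with intersections and unions.\<close>

lemma openin_zariski_subset:
  assumes "X \<subseteq> Y" "openin (zariski X) U"
  shows "\<exists>U'. openin (zariski Y) U' \<and> U = U' \<inter> X"
proof -
  have "generate_topology_on {{P \<in> X. at_pt p P \<noteq> 0} | p. \<exists>d. homogeneous d p} U"
    using assms(2) unfolding zariski_def by (rule openin_topology_generated_by)
  then show ?thesis
  proof induction
    case Empty
    then show ?case by (intro exI[of _ "{}"]) auto
  next
    case (Int a b)
    then show ?case by (metis (no_types, lifting) Int_assoc Int_commute Int_left_absorb openin_Int)
  next
    case (UN K)
    then obtain F where F: "\<And>k. k \<in> K \<Longrightarrow> openin (zariski Y) (F k) \<and> k = F k \<inter> X"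
      by metis
    then show ?case
      by (intro exI[of _ "\<Union>(F ` K)"]) blast
  next
    case (Basis s)
    then obtain d p where "s = {P \<in> X. at_pt p P \<noteq> 0}" "homogeneous d p" by blast
    then show ?case
      using assms(1) openin_zariski_nonzero[of d p Y]
      by (intro exI[of _ "{P \<in> Y. at_pt p P \<noteq> 0}"]) auto
  qed
qed

text \<open>Irreducibility in the form in which it is applied: nonempty open sets are dense, so an
  identity of regular functions that holds on one of them holds throughout.\<close>

definition irreducible_space :: "('p, 'k) space \<Rightarrow> bool" where
  "irreducible_space X \<longleftrightarrow> (\<forall>U V. openin (zar X) U \<and> openin (zar X) V \<and> U \<noteq> {} \<and> V \<noteq> {} \<longrightarrow> U \<inter> V \<noteq> {})"

text \<open>The complements of \<open>U\<close> and \<open>V\<close> would be closed sets covering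
  \<open>Z\<close>. This serves both a variety inside projective space and a prime divisor inside a
  variety.\<close>

lemma irreducible_in_open_Int:
  assumes "irreducible_in T Z" "openin T U" "openin T V" "U \<inter> Z \<noteq> {}" "V \<inter> Z \<noteq> {}"
  shows "U \<inter> V \<inter> Z \<noteq> {}"
proof
  assume "U \<inter> V \<inter> Z = {}"
  then have "Z \<subseteq> (topspace T - U) \<union> (topspace T - V)"
    using assms(1) by (auto simp: irreducible_in_def)
  then have "Z \<subseteq> topspace T - U \<or> Z \<subseteq> topspace T - V"
    using assms(1-3) unfolding irreducible_in_def by blast
  with assms(4,5) show False by blast
qed

lemma irreducible_space_var:
  assumes "projective_variety X"
  shows "irreducible_space (var X)"
  unfolding irreducible_space_def
proof (intro allI impI, elim conjE)
  fix U V assume UV: "openin (zar (var X)) U" "openin (zar (var X)) V" "U \<noteq> {}" "V \<noteq> {}"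
  from assms obtain n where n: "irreducible_in (zariski (proj_space n)) X"
    unfolding projective_variety_def by blast
  then have "X \<subseteq> proj_space n" by (simp add: irreducible_in_def topspace_zariski)
  from openin_zariski_subset[OF this] UV(1,2) obtain U' V' where
    "openin (zariski (proj_space n)) U'" "U = U' \<inter> X"
    "openin (zariski (proj_space n)) V'" "V = V' \<inter> X"
    unfolding zar_var by meson
  then show "U \<inter> V \<noteq> {}"
    using irreducible_in_open_Int[OF n, of U' V'] UV(3,4) by auto
qed

subsection \<open>The group of principal divisors\<close>

lemma local_equation_factor:
  assumes "local_equation X Z V \<pi>" "openin (zar X) W" "W \<subseteq> V" "g \<in> reg X W" "\<forall>x \<in> Z \<inter> W. g x = 0"
  shows "\<exists>h \<in> reg X W. \<forall>x \<in> W. g x = h x * \<pi> x"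
  using assms unfolding local_equation_def by blast

lemma ord_alongI:
  assumes "openin (zar X) V" "V \<inter> Z \<noteq> {}" "local_equation X Z V \<pi>"
     "u \<in> reg X V" "\<And>x. x \<in> V \<Longrightarrow> u x \<noteq> 0"
     "openin (zar X) W" "W \<noteq> {}" "W \<subseteq> V" "\<And>x. x \<in> W \<Longrightarrow> f x = u x * \<pi> x powi n"
  shows "ord_along X Z f n"
  unfolding ord_along_def using assms by blast

lemma ord_alongE:
  assumes "ord_along X Z f n"
  obtains V \<pi> u W where "openin (zar X) V" "V \<inter> Z \<noteq> {}" "local_equation X Z V \<pi>"
     "u \<in> reg X V" "\<And>x. x \<in> V \<Longrightarrow> u x \<noteq> 0"
     "openin (zar X) W" "W \<noteq> {}" "W \<subseteq> V" "\<And>x. x \<in> W \<Longrightarrow> f x = u x * \<pi> x powi n"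
  using assms unfolding ord_along_def by blast

context function_space
begin

lemma reg_power: "openin (zar X) U \<Longrightarrow> f \<in> reg X U \<Longrightarrow> (\<lambda>x. f x ^ n) \<in> reg X U"
  by (induction n) (auto intro: reg_const reg_mult)

lemma reg_powi:
  assumes "openin (zar X) U" "f \<in> reg X U" "\<And>x. x \<in> U \<Longrightarrow> f x \<noteq> 0"
  shows "(\<lambda>x. f x powi n) \<in> reg X U"
proof (cases "n \<ge> 0")
  case True
  then show ?thesis using reg_power[OF assms(1,2)] by (simp add: power_int_def)
next
  case False
  then show ?thesis
    using reg_power[OF assms(1) reg_inverse[OF assms(2,3)]] by (simp add: power_int_def)
qed

lemma reg_divide:
  assumes "f \<in> reg X U" "g \<in> reg X U" "\<And>x. x \<in> U \<Longrightarrow> g x \<noteq> 0"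
  shows "(\<lambda>x. f x / g x) \<in> reg X U"
  using reg_mult[OF assms(1) reg_inverse[OF assms(2,3)]] by (simp add: divide_inverse)

lemma local_equation_restrict:
  assumes "local_equation X Z V \<pi>" "openin (zar X) W" "W \<subseteq> V"
  shows "local_equation X Z W \<pi>"
  unfolding local_equation_def
proof (intro conjI allI impI)
  show "\<pi> \<in> reg X W" using assms by (auto simp: local_equation_def intro: reg_restrict)
  show "{x \<in> W. \<pi> x = 0} = Z \<inter> W" using assms by (auto simp: local_equation_def)
  fix W' g assume "openin (zar X) W' \<and> W' \<subseteq> W \<and> g \<in> reg X W' \<and> (\<forall>x\<in>Z \<inter> W'. g x = 0)"
  then show "\<exists>h\<in>reg X W'. \<forall>x\<in>W'. g x = h x * \<pi> x"
    using local_equation_factor[OF assms(1), of W' g] assms(3) by blast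
qed

end

locale irreducible_function_space = function_space X
  for X :: "('p, 'k::field) space" +
  assumes irreducible: "irreducible_space X"
begin

lemma open_Int_nonempty:
  "openin (zar X) U \<Longrightarrow> openin (zar X) V \<Longrightarrow> U \<noteq> {} \<Longrightarrow> V \<noteq> {} \<Longrightarrow> U \<inter> V \<noteq> {}"
  using irreducible by (simp add: irreducible_space_def)

lemma prime_divisor_compl:
  assumes "Z \<in> prime_divisors X"
  shows "openin (zar X) (points X - Z)" "points X - Z \<noteq> {}"
  using assms closedin_subset[of "zar X" Z]
  by (auto simp: prime_divisors_def closed_irreducible_def)

text \<open>If \<open>\<pi>' = h \<pi>\<close> and \<open>\<pi> = h' \<pi>'\<close>, then \<open>h h' = 1\<close> off \<open>Z\<close>, hence everywhere by density.\<close>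

lemma local_equation_unit:
  assumes Z: "Z \<in> prime_divisors X" and V: "openin (zar X) V"
    and e: "local_equation X Z V \<pi>" and e': "local_equation X Z V \<pi>'"
  obtains h where "h \<in> reg X V" "\<And>x. x \<in> V \<Longrightarrow> h x \<noteq> 0" "\<And>x. x \<in> V \<Longrightarrow> \<pi>' x = h x * \<pi> x"
proof -
  have zeros: "\<pi> x = 0 \<longleftrightarrow> x \<in> Z" "\<pi>' x = 0 \<longleftrightarrow> x \<in> Z" if "x \<in> V" for x
    using e e' that unfolding local_equation_def by blast+
  have reg: "\<pi> \<in> reg X V" "\<pi>' \<in> reg X V" using e e' by (auto simp: local_equation_def)
  have "\<forall>x \<in> Z \<inter> V. \<pi>' x = 0" "\<forall>x \<in> Z \<inter> V. \<pi> x = 0"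
    using zeros by blast+
  then obtain h h' where h: "h \<in> reg X V" "\<forall>x\<in>V. \<pi>' x = h x * \<pi> x"
    and h': "h' \<in> reg X V" "\<forall>x\<in>V. \<pi> x = h' x * \<pi>' x"
    using local_equation_factor[OF e V subset_refl reg(2)]
      local_equation_factor[OF e' V subset_refl reg(1)] by blast
  let ?N = "{x \<in> V. h x * h' x - 1 \<noteq> 0}"
  have N: "openin (zar X) ?N"
    by (intro openin_nonzero reg_diff reg_mult h(1) h'(1) reg_const V)
  have "h x * h' x = 1" if x: "x \<in> V" "x \<notin> Z" for x
  proof -
    have "\<pi>' x = h x * \<pi> x" "\<pi> x = h' x * \<pi>' x" using h h' x by blast+
    then have "\<pi> x = (h x * h' x) * \<pi> x" by (metis mult.assoc mult.commute)
    then show ?thesis using zeros(1)[OF x(1)] x(2) by simp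
  qed
  then have "?N \<inter> (points X - Z) = {}" by auto
  then have "?N = {}"
    using open_Int_nonempty[OF N prime_divisor_compl(1)[OF Z]] prime_divisor_compl(2)[OF Z] by blast
  then have "h x \<noteq> 0" if "x \<in> V" for x using that by force
  then show ?thesis using that h by blast
qed

text \<open>The two orders come with local equations \<open>p1\<close> and \<open>p2\<close> on
  different neighbourhoods. On the intersection \<open>p2 = h * p1\<close> with a unit
  \<open>h\<close>, so the quotient is \<open>p1 powi (n - m)\<close> times the unit
  \<open>u1 / (u2 * h powi m)\<close>.\<close>

lemma ord_along_divide:
  assumes Z: "Z \<in> prime_divisors X" and f: "ord_along X Z f n" and g: "ord_along X Z g m"
  shows "ord_along X Z (\<lambda>x. f x / g x) (n - m)"
proof -
  obtain V1 p1 u1 W1 where 1: "openin (zar X) V1" "V1 \<inter> Z \<noteq> {}" "local_equation X Z V1 p1"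
     "u1 \<in> reg X V1" "\<And>x. x \<in> V1 \<Longrightarrow> u1 x \<noteq> 0"
     "openin (zar X) W1" "W1 \<noteq> {}" "W1 \<subseteq> V1" "\<And>x. x \<in> W1 \<Longrightarrow> f x = u1 x * p1 x powi n"
    using f by (rule ord_alongE) (rule that)
  obtain V2 p2 u2 W2 where 2: "openin (zar X) V2" "V2 \<inter> Z \<noteq> {}" "local_equation X Z V2 p2"
     "u2 \<in> reg X V2" "\<And>x. x \<in> V2 \<Longrightarrow> u2 x \<noteq> 0"
     "openin (zar X) W2" "W2 \<noteq> {}" "W2 \<subseteq> V2" "\<And>x. x \<in> W2 \<Longrightarrow> g x = u2 x * p2 x powi m"
    using g by (rule ord_alongE) (rule that)
  define V where "V = V1 \<inter> V2"
  have V: "openin (zar X) V" using 1 2 by (auto simp: V_def)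
  \<comment> \<open>Irreducibility of \<open>Z\<close>, not of \<open>X\<close>, is what makes the
    common neighbourhood still meet \<open>Z\<close>.\<close>
  have "irreducible_in (zar X) Z" using Z by (simp add: prime_divisors_def closed_irreducible_def)
  then have VZ: "V \<inter> Z \<noteq> {}"
    using irreducible_in_open_Int[of "zar X" Z V1 V2] 1 2 by (simp add: V_def)
  have e1: "local_equation X Z V p1" and e2: "local_equation X Z V p2"
    using local_equation_restrict[OF 1(3) V] local_equation_restrict[OF 2(3) V] by (auto simp: V_def)
  from local_equation_unit[OF Z V e1 e2] obtain h where
    h: "h \<in> reg X V" "\<And>x. x \<in> V \<Longrightarrow> h x \<noteq> 0" "\<And>x. x \<in> V \<Longrightarrow> p2 x = h x * p1 x"
    by blast
  have u: "u1 \<in> reg X V" "u2 \<in> reg X V"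
    using 1(4) 2(4) V by (auto simp: V_def intro: reg_restrict)
  define w where "w = (\<lambda>x. u1 x / (u2 x * h x powi m))"
  have wreg: "w \<in> reg X V" unfolding w_def
    by (intro reg_divide reg_mult reg_powi u h V) (use 2(5) h V_def in auto)
  have wnz: "w x \<noteq> 0" if "x \<in> V" for x using 1(5) 2(5) h(2) that by (auto simp: w_def V_def)
  \<comment> \<open>Off \<open>Z\<close> the local equation \<open>p1\<close> is nonzero, so that
    integer exponents may be subtracted; irreducibility of \<open>X\<close> keeps the set
    nonempty.\<close>
  define W where "W = W1 \<inter> W2 \<inter> (points X - Z)"
  have W: "openin (zar X) W" using 1 2 prime_divisor_compl[OF Z] by (auto simp: W_def)
  have Wne: "W \<noteq> {}" unfolding W_def
    using 1 2 prime_divisor_compl[OF Z] by (intro open_Int_nonempty openin_Int) auto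
  have WV: "W \<subseteq> V" using 1 2 by (auto simp: W_def V_def)
  have eq: "f x / g x = w x * p1 x powi (n - m)" if x: "x \<in> W" for x
  proof -
    have xV: "x \<in> V" and xZ: "x \<notin> Z" using x WV by (auto simp: W_def)
    have "p1 x \<noteq> 0" using e1 xV xZ unfolding local_equation_def by blast
    moreover have "h x \<noteq> 0" "u2 x \<noteq> 0" using h xV 2(5) V_def by auto
    moreover have "f x = u1 x * p1 x powi n" "g x = u2 x * p2 x powi m" "p2 x = h x * p1 x"
      using 1 2 x h(3)[OF xV] by (auto simp: W_def)
    ultimately show ?thesis
      by (simp add: w_def power_int_diff power_int_mult_distrib mult.assoc)
  qed
  show ?thesis
    by (rule ord_alongI[OF V VZ e1 wreg wnz W Wne WV eq])
qed

lemma rational_functions_divide: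
  assumes f: "f \<in> rational_functions X - generically_zero X"
    and g: "g \<in> rational_functions X - generically_zero X"
  shows "(\<lambda>x. f x / g x) \<in> rational_functions X - generically_zero X"
proof
  from f g obtain U V where U: "openin (zar X) U" "U \<noteq> {}" "f \<in> reg X U"
    and V: "openin (zar X) V" "V \<noteq> {}" "g \<in> reg X V"
    unfolding rational_functions_def by blast
  let ?W = "{x \<in> V. g x \<noteq> 0}"
  have W: "openin (zar X) ?W" using openin_nonzero V by blast
  have Wne: "?W \<noteq> {}" using g V unfolding generically_zero_def by blast
  have UW: "openin (zar X) (U \<inter> ?W)" "U \<inter> ?W \<noteq> {}"
    using U W Wne open_Int_nonempty by auto
  have "(\<lambda>x. f x / g x) \<in> reg X (U \<inter> ?W)"
    by (intro reg_divide reg_restrict[OF U(3)] reg_restrict[OF V(3)] UW) auto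
  then show "(\<lambda>x. f x / g x) \<in> rational_functions X"
    using UW unfolding rational_functions_def by blast
  show "(\<lambda>x. f x / g x) \<notin> generically_zero X"
  proof
    assume "(\<lambda>x. f x / g x) \<in> generically_zero X"
    then obtain S where S: "openin (zar X) S" "S \<noteq> {}" "\<forall>x\<in>S. f x / g x = 0"
      unfolding generically_zero_def by blast
    \<comment> \<open>Since division by 0 yields 0, the vanishing of \<open>f / g\<close> gives the
      vanishing of \<open>f\<close> only where \<open>g\<close> is nonzero.\<close>
    have "S \<inter> ?W \<noteq> {}" "openin (zar X) (S \<inter> ?W)" "\<forall>x\<in>S \<inter> ?W. f x = 0"
      using S W Wne open_Int_nonempty by auto
    then have "f \<in> generically_zero X" unfolding generically_zero_def by blast
    with f show False by blast
  qed
qed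

lemma principal_divisors_diff:
  assumes "D \<in> principal_divisors X" "E \<in> principal_divisors X"
  shows "D - E \<in> principal_divisors X"
proof -
  from assms obtain f g where f: "f \<in> rational_functions X - generically_zero X"
      "\<forall>Z \<in> prime_divisors X. ord_along X Z f (Poly_Mapping.lookup D Z)"
    and g: "g \<in> rational_functions X - generically_zero X"
      "\<forall>Z \<in> prime_divisors X. ord_along X Z g (Poly_Mapping.lookup E Z)"
    and D: "D \<in> divisors X" "E \<in> divisors X"
    unfolding principal_divisors_def by blast
  have "D - E \<in> divisors X" using D keys_diff[of D E] by auto
  moreover have "\<forall>Z \<in> prime_divisors X.
      ord_along X Z (\<lambda>x. f x / g x) (Poly_Mapping.lookup (D - E) Z)"
    using f g by (simp add: lookup_minus ord_along_divide)
  ultimately show ?thesis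
    using rational_functions_divide[OF f(1) g(1)] unfolding principal_divisors_def by blast
qed

end

lemma irreducible_function_space_var:
  "projective_variety X \<Longrightarrow> irreducible_function_space (var X)"
  by (simp add: irreducible_function_space_def irreducible_function_space_axioms_def
      function_space_var irreducible_space_var)

section \<open>The groups NS and NS/Z\<theta>\<close>

text \<open>Zero, negatives and sums are all obtained from differences, so that geometry has to
  supply a single closure property.\<close>

lemma subgroup_free_Abelian_groupI:
  assumes "P \<subseteq> carrier (free_Abelian_group S)" "P \<noteq> {}"
    and diff: "\<And>D E. D \<in> P \<Longrightarrow> E \<in> P \<Longrightarrow> D - E \<in> P"
  shows "subgroup P (free_Abelian_group S)"
proof -
  have zero: "0 \<in> P" using assms(2) diff by (metis diff_self ex_in_conv)
  have neg: "- D \<in> P" if "D \<in> P" for D using diff[OF zero that] by simp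
  have add: "D + E \<in> P" if "D \<in> P" "E \<in> P" for D E
    using diff[OF that(1) neg[OF that(2)]] by simp
  show ?thesis
  proof
    show "inv\<^bsub>free_Abelian_group S\<^esub> x \<in> P" if "x \<in> P" for x
    proof -
      have "x \<in> carrier (free_Abelian_group S)" using that assms(1) by blast
      then show ?thesis using neg[OF that] by simp
    qed
  qed (use assms(1) zero add in auto)
qed

lemma push_divisor_diff: "push_divisor \<phi> (D - E) = push_divisor \<phi> D - push_divisor \<phi> E"
  by (simp add: push_divisor_def frag_extend_diff)

text \<open>A principal divisor, even \<open>0\<close>, exists only if every prime divisor has a local equation near its
  generic point, a consequence of smoothness. The bijection in the definition of a principal
  polarization yields this without a proof of smoothness: its target is nonempty.\<close>

lemma subgroup_pic0_divisors:
  assumes "ppas A \<theta>"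
  shows "subgroup (pic0_divisors A) (div_group (avar A))"
proof (rule subgroup_free_Abelian_groupI)
  have pv: "projective_variety (carrier A)"
    using assms by (simp add: ppas_def abelian_variety_def)
  interpret irreducible_function_space "avar A"
    by (rule irreducible_function_space_var[OF pv])
  show "pic0_divisors A \<subseteq> divisors (avar A)"
    unfolding pic0_divisors_def by blast
  from assms have "carrier A \<noteq> {}"
    unfolding ppas_def abelian_variety_def using group.is_monoid monoid.one_closed by blast
  with assms show "pic0_divisors A \<noteq> {}"
    unfolding ppas_def principal_polarization_def bij_betw_def by blast
  fix D E assume D: "D \<in> pic0_divisors A" and E: "E \<in> pic0_divisors A"
  have DE: "F - G \<in> divisors (avar A)" if "F \<in> divisors (avar A)" "G \<in> divisors (avar A)" for F G
    using that keys_diff[of F G] by auto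
  have "lin_equiv (avar A) (translate_pullback A a (D - E)) (D - E)" if a: "a \<in> carrier A" for a
  proof -
    let ?t = "translate_pullback A a"
    have 1: "?t D \<in> divisors (avar A)" "D \<in> divisors (avar A)" "?t D - D \<in> principal_divisors (avar A)"
        "?t E \<in> divisors (avar A)" "E \<in> divisors (avar A)" "?t E - E \<in> principal_divisors (avar A)"
      using D E a unfolding pic0_divisors_def lin_equiv_def by blast+
    have 2: "?t (D - E) = ?t D - ?t E" by (simp add: translate_pullback_def push_divisor_diff)
    have "(?t D - ?t E) - (D - E) = (?t D - D) - (?t E - E)" by simp
    with 1 show ?thesis
      unfolding lin_equiv_def 2 by (metis DE principal_divisors_diff)
  qed
  moreover have "D - E \<in> divisors (avar A)"
    using DE D E unfolding pic0_divisors_def by blast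
  ultimately show "D - E \<in> pic0_divisors A"
    unfolding pic0_divisors_def by blast
qed

lemma comm_group_NS: "ppas A \<theta> \<Longrightarrow> comm_group (NS A)"
  unfolding NS_def
  by (intro comm_group.abelian_FactGroup abelian_free_Abelian_group subgroup_pic0_divisors)

lemma theta_in_NS: "ppas A \<theta> \<Longrightarrow> \<theta> \<in> carrier (NS A)"
  unfolding ppas_def principal_polarization_def ns_class_def NS_def carrier_FactGroup by blast

lemma subgroup_generate_theta:
  assumes "ppas A \<theta>"
  shows "subgroup (generate (NS A) {\<theta>}) (NS A)"
proof -
  interpret comm_group "NS A" using assms by (rule comm_group_NS)
  show ?thesis by (rule generate_is_subgroup) (use theta_in_NS[OF assms] in simp)
qed

lemma comm_group_NS_mod_theta: "ppas A \<theta> \<Longrightarrow> comm_group (NS_mod_theta A \<theta>)"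
  unfolding NS_mod_theta_def
  by (rule comm_group.abelian_FactGroup[OF comm_group_NS subgroup_generate_theta])

text \<open>\<open>finprod\<close> behaves as a product only in a commutative structure; this is why
  NS/Z\<theta> must be known to be a commutative group before a coordinate vector yields an element
  of it.\<close>

lemma (in comm_group) int_comb_closed:
  assumes "\<And>i. i < n \<Longrightarrow> b i \<in> carrier G"
  shows "int_comb G n b x \<in> carrier G"
  unfolding int_comb_def using assms by (intro finprod_closed) auto

subsection \<open>Transport along isomorphisms\<close>

text \<open>If neither predicate has a witness, the predicates are equal and so are the unspecified
  values of \<open>LEAST\<close>. This covers quotients without a finite spanning set.\<close>

lemma Least_eq_mutual:
  fixes P Q :: "nat \<Rightarrow> bool"
  assumes PQ: "\<And>n. P n \<Longrightarrow> \<exists>m\<le>n. Q m" and QP: "\<And>n. Q n \<Longrightarrow> \<exists>m\<le>n. P m"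
  shows "(LEAST n. P n) = (LEAST n. Q n)"
proof (cases "\<exists>n. P n")
  case True
  then obtain n where n: "P n" by blast
  have P: "P (LEAST n. P n)" using n by (rule LeastI)
  then obtain m where m: "m \<le> (LEAST n. P n)" "Q m" using PQ by blast
  have Q: "Q (LEAST n. Q n)" using m(2) by (rule LeastI)
  then obtain k where k: "k \<le> (LEAST n. Q n)" "P k" using QP by blast
  show ?thesis
    using Least_le[of P k, OF k(2)] Least_le[of Q m, OF m(2)] m(1) k(1) by linarith
next
  case False
  then have "P = (\<lambda>_. False)" "Q = (\<lambda>_. False)" using QP by blast+
  then show ?thesis by simp
qed

lemma module_fun: "Modules.module (\<lambda>c (f :: 'p \<Rightarrow> 'k::field) x. c * f x)"
  by standard (auto simp: algebra_simps)

lemma fun_span_comp: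
  fixes f :: "'r \<Rightarrow> 'k::field"
  assumes "f \<in> fun_span S"
  shows "f \<circ> \<phi> \<in> fun_span ((\<lambda>g. g \<circ> \<phi>) ` S)"
proof -
  interpret R: Modules.module "\<lambda>c (f :: 'r \<Rightarrow> 'k) x. c * f x" by (rule module_fun)
  interpret P: Modules.module "\<lambda>c (f :: 'p \<Rightarrow> 'k) x. c * f x" by (rule module_fun)
  from assms show ?thesis
  proof (induction rule: R.span_induct_alt)
    case base
    have zero: "(0 :: 'r \<Rightarrow> 'k) \<circ> \<phi> = 0" by auto
    show ?case unfolding zero by (rule P.span_zero)
  next
    case (step c x y)
    have eq: "((\<lambda>z. c * x z) + y) \<circ> \<phi> = (\<lambda>z. c * (x \<circ> \<phi>) z) + (y \<circ> \<phi>)" by auto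
    have "x \<circ> \<phi> \<in> fun_span ((\<lambda>g. g \<circ> \<phi>) ` S)" using step by (intro P.span_base) blast
    then show ?case unfolding eq by (intro P.span_add P.span_scale step.IH)
  qed
qed

text \<open>Composition with \<open>\<phi>\<close> maps \<open>V\<close> onto \<open>V'\<close>
  modulo \<open>W'\<close>, so a finite set spanning \<open>V\<close> modulo \<open>W\<close> goes
  to one spanning \<open>V'\<close> modulo \<open>W'\<close>. Its cardinality may drop, hence
  \<open>m \<le> n\<close>; equality of dimensions will come from the inverse map.\<close>

lemma quot_dim_comp:
  fixes V W :: "('r \<Rightarrow> 'k::field) set" and V' W' :: "('p \<Rightarrow> 'k) set"
  assumes V: "\<And>g. g \<in> V \<Longrightarrow> g \<circ> \<phi> \<in> V'" and W: "\<And>g. g \<in> W \<Longrightarrow> g \<circ> \<phi> \<in> W'"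
    and V': "\<And>f. f \<in> V' \<Longrightarrow> \<exists>g \<in> V. f - (g \<circ> \<phi>) \<in> W'"
    and B: "\<exists>B. finite B \<and> card B = n \<and> B \<subseteq> V \<and> V \<subseteq> fun_span (B \<union> W)"
  shows "\<exists>m\<le>n. \<exists>B. finite B \<and> card B = m \<and> B \<subseteq> V' \<and> V' \<subseteq> fun_span (B \<union> W')"
proof -
  interpret P: Modules.module "\<lambda>c (f :: 'p \<Rightarrow> 'k) x. c * f x" by (rule module_fun)
  from B obtain B where B: "finite B" "card B = n" "B \<subseteq> V" "V \<subseteq> fun_span (B \<union> W)" by blast
  let ?B = "(\<lambda>g. g \<circ> \<phi>) ` B"
  have "f \<in> fun_span (?B \<union> W')" if f: "f \<in> V'" for f
  proof -
    obtain g where g: "g \<in> V" "f - (g \<circ> \<phi>) \<in> W'" using V'[OF f] by blast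
    have "g \<circ> \<phi> \<in> fun_span ((\<lambda>g. g \<circ> \<phi>) ` (B \<union> W))"
      using g B by (intro fun_span_comp) blast
    moreover have "(\<lambda>g. g \<circ> \<phi>) ` (B \<union> W) \<subseteq> ?B \<union> W'" using W by blast
    ultimately have "g \<circ> \<phi> \<in> fun_span (?B \<union> W')" using P.span_mono by blast
    moreover have "f - (g \<circ> \<phi>) \<in> fun_span (?B \<union> W')" using g by (intro P.span_base) blast
    ultimately have "(f - (g \<circ> \<phi>)) + (g \<circ> \<phi>) \<in> fun_span (?B \<union> W')" by (intro P.span_add)
    then show ?thesis by simp
  qed
  moreover have "card ?B \<le> n" using B card_image_le by blast
  moreover have "?B \<subseteq> V'" using B V by blast
  moreover have "finite ?B" using B by blast
  ultimately show ?thesis by blast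
qed

section \<open>Push-forward of divisors\<close>

text \<open>The coefficient at \<open>f z\<close> collects those of all elements with the same
  image; injectivity leaves one term.\<close>

lemma lookup_frag_extend_inj:
  assumes "inj_on f S" "Poly_Mapping.keys D \<subseteq> S" "z \<in> S"
  shows "Poly_Mapping.lookup (frag_extend (\<lambda>z. frag_of (f z)) D) (f z) = Poly_Mapping.lookup D z"
proof -
  have "Poly_Mapping.lookup (frag_extend (\<lambda>z. frag_of (f z)) D) (f z)
      = (\<Sum>i\<in>Poly_Mapping.keys D. Poly_Mapping.lookup D i * (if f z = f i then 1 else 0))"
    unfolding frag_extend_def by (simp add: lookup_sum)
  also have "\<dots> = (\<Sum>i\<in>Poly_Mapping.keys D. if i = z then Poly_Mapping.lookup D i else 0)"
    using assms by (intro sum.cong) (auto dest: inj_onD)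
  also have "\<dots> = Poly_Mapping.lookup D z" by (auto simp: in_keys_iff)
  finally show ?thesis .
qed

lemma keys_push_divisor_subset: "Poly_Mapping.keys (push_divisor \<phi> D) \<subseteq> (`) \<phi> ` Poly_Mapping.keys D"
  using keys_frag_extend[of "\<lambda>Z. frag_of (\<phi> ` Z)" D] unfolding push_divisor_def by auto

lemma push_divisor_add: "push_divisor \<phi> (D + E) = push_divisor \<phi> D + push_divisor \<phi> E"
  by (simp add: push_divisor_def frag_extend_add)

lemma push_divisor_push: "push_divisor \<psi> (push_divisor \<phi> D) = push_divisor (\<psi> \<circ> \<phi>) D"
  using frag_extend_compose[of "\<lambda>Z. frag_of (\<psi> ` Z)" "(`) \<phi>" D]
  by (simp add: push_divisor_def comp_def image_image)

text \<open>An isomorphism followed by its inverse is the identity only on points of the space, so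
  maps have to be compared on the members of the supporting sets.\<close>

lemma push_divisor_cong:
  "(\<And>Z x. Z \<in> Poly_Mapping.keys D \<Longrightarrow> x \<in> Z \<Longrightarrow> \<phi> x = \<psi> x) \<Longrightarrow> push_divisor \<phi> D = push_divisor \<psi> D"
  unfolding push_divisor_def by (rule frag_extend_eq) (metis image_cong)

lemma push_divisor_id: "push_divisor (\<lambda>x. x) D = D"
  using frag_expansion[of D] by (simp add: push_divisor_def)

lemma prime_divisor_subset: "Z \<in> prime_divisors X \<Longrightarrow> Z \<subseteq> points X"
  by (auto simp: prime_divisors_def closed_irreducible_def dest: closedin_subset)

section \<open>Isomorphisms of spaces with functions\<close>

text \<open>With both maps as parameters the locale is symmetric: interpreting it again with the
  roles exchanged, under the prefix \<open>inv\<close>, provides every result for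
  \<open>\<psi>\<close> as well.\<close>

locale space_iso = X: function_space X + Y: function_space Y
  for X :: "('p, 'k::field) space" and Y :: "('r, 'k) space" +
  fixes \<phi> \<psi>
  assumes morphism_to: "morphism X Y \<phi>" and morphism_from: "morphism Y X \<psi>"
    and inverse_left: "\<And>x. x \<in> points X \<Longrightarrow> \<psi> (\<phi> x) = x"
    and inverse_right: "\<And>y. y \<in> points Y \<Longrightarrow> \<phi> (\<psi> y) = y"
begin

lemma sym: "space_iso Y X \<psi> \<phi>"
  by (simp add: space_iso_def space_iso_axioms_def X.function_space_axioms Y.function_space_axioms
      morphism_to morphism_from inverse_left inverse_right)

lemma map_points: "x \<in> points X \<Longrightarrow> \<phi> x \<in> points Y"
  using morphism_to by (auto simp: morphism_def continuous_map_def)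

lemma image_points: "A \<subseteq> points X \<Longrightarrow> \<phi> ` A \<subseteq> points Y"
  using map_points by blast

lemma image_inverse: "A \<subseteq> points X \<Longrightarrow> \<psi> ` \<phi> ` A = A"
  using inverse_left by (force simp: image_image)

lemma inj_on_points: "inj_on \<phi> (points X)"
  using inverse_left by (metis inj_on_inverseI)

end

sublocale space_iso \<subseteq> inv: space_iso Y X \<psi> \<phi>
  by (rule sym)

text \<open>Continuity and the condition on regular functions speak of preimages. Reading an image
  under \<open>\<phi>\<close> as a preimage under \<open>\<psi>\<close> lets open sets, closed sets
  and regular functions be carried forward.\<close>

lemma (in space_iso) image_eq_vimage: "U \<subseteq> points X \<Longrightarrow> \<phi> ` U = {y \<in> points Y. \<psi> y \<in> U}"
  using map_points inverse_left inverse_right inv.map_points by force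

lemma (in space_iso) openin_image: "openin (zar X) U \<Longrightarrow> openin (zar Y) (\<phi> ` U)"
  using morphism_from image_eq_vimage[of U] openin_subset[of "zar X" U]
  by (simp add: morphism_def continuous_map_def)

lemma (in space_iso) reg_image: "openin (zar X) U \<Longrightarrow> f \<in> reg X U \<Longrightarrow> f \<circ> \<psi> \<in> reg Y (\<phi> ` U)"
  using morphism_from image_eq_vimage[of U] openin_subset[of "zar X" U]
  by (simp add: morphism_def)

lemma (in space_iso) closedin_image: "closedin (zar X) F \<Longrightarrow> closedin (zar Y) (\<phi> ` F)"
  using morphism_from image_eq_vimage[of F] closedin_subset[of "zar X" F]
  by (simp add: morphism_def continuous_map_closedin)

lemma (in space_iso) irreducible_image:
  assumes "irreducible_in (zar X) Z"
  shows "irreducible_in (zar Y) (\<phi> ` Z)"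
  unfolding irreducible_in_def
proof (intro conjI allI impI; (elim conjE)?)
  have Z: "Z \<subseteq> points X" "Z \<noteq> {}" using assms by (auto simp: irreducible_in_def)
  then show "\<phi> ` Z \<noteq> {}" "\<phi> ` Z \<subseteq> points Y" using image_points by auto
  fix F G assume F: "closedin (zar Y) F" and G: "closedin (zar Y) G" and ZFG: "\<phi> ` Z \<subseteq> F \<union> G"
  have FG: "F \<subseteq> points Y" "G \<subseteq> points Y" using F G closedin_subset by blast+
  have "Z \<subseteq> \<psi> ` F \<union> \<psi> ` G"
    using image_mono[OF ZFG, of \<psi>] image_inverse[OF Z(1)] by (simp add: image_Un)
  then have "Z \<subseteq> \<psi> ` F \<or> Z \<subseteq> \<psi> ` G"
    using assms inv.closedin_image[OF F] inv.closedin_image[OF G]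
    unfolding irreducible_in_def by blast
  then show "\<phi> ` Z \<subseteq> F \<or> \<phi> ` Z \<subseteq> G"
    using image_mono[of Z _ \<phi>] inv.image_inverse[OF FG(1)] inv.image_inverse[OF FG(2)] by metis
qed

lemma (in space_iso) closed_irreducible_image: "closed_irreducible X Z \<Longrightarrow> closed_irreducible Y (\<phi> ` Z)"
  by (simp add: closed_irreducible_def closedin_image irreducible_image)

lemma (in space_iso) image_whole: "\<phi> ` points X = points Y"
  using image_eq_vimage[of "points X"] inv.map_points by blast

lemma (in space_iso) prime_divisor_image:
  assumes "Z \<in> prime_divisors X"
  shows "\<phi> ` Z \<in> prime_divisors Y"
proof -
  have Z: "closed_irreducible X Z" "Z \<noteq> points X" "Z \<subseteq> points X"
    using assms prime_divisor_subset by (auto simp: prime_divisors_def)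
  have "\<phi> ` Z \<noteq> points Y"
    using Z image_inverse[OF Z(3)] inv.image_whole by metis
  moreover have "T = \<phi> ` Z \<or> T = points Y"
    if T: "closed_irreducible Y T" "\<phi> ` Z \<subseteq> T" for T
  proof -
    have TY: "T \<subseteq> points Y" using T by (auto simp: closed_irreducible_def dest: closedin_subset)
    have "Z \<subseteq> \<psi> ` T" using image_mono[OF T(2), of \<psi>] image_inverse[OF Z(3)] by simp
    then have "\<psi> ` T = Z \<or> \<psi> ` T = points X"
      using assms inv.closed_irreducible_image[OF T(1)] unfolding prime_divisors_def by blast
    then show ?thesis using inv.image_inverse[OF TY] image_whole by metis
  qed
  ultimately show ?thesis
    using closed_irreducible_image[OF Z(1)] unfolding prime_divisors_def by blast
qed

lemma (in space_iso) image_Int_points: "A \<subseteq> points X \<Longrightarrow> B \<subseteq> points X \<Longrightarrow> \<phi> ` (A \<inter> B) = \<phi> ` A \<inter> \<phi> ` B"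
  using inj_on_points by (rule inj_on_image_Int)

lemma (in space_iso) local_equation_image:
  assumes e: "local_equation X Z V \<pi>" and V: "openin (zar X) V" and Z: "Z \<subseteq> points X"
  shows "local_equation Y (\<phi> ` Z) (\<phi> ` V) (\<pi> \<circ> \<psi>)"
  unfolding local_equation_def
proof (intro conjI allI impI; (elim conjE)?)
  have VX: "V \<subseteq> points X" using V by (rule openin_subset)
  show "\<pi> \<circ> \<psi> \<in> reg Y (\<phi> ` V)" using e V by (intro reg_image) (auto simp: local_equation_def)
  have "{x \<in> \<phi> ` V. (\<pi> \<circ> \<psi>) x = 0} = \<phi> ` {x \<in> V. \<pi> x = 0}"
    using VX inverse_left by (force simp: subset_iff)
  also have "\<dots> = \<phi> ` Z \<inter> \<phi> ` V"
    using e image_Int_points[OF Z VX] by (simp add: local_equation_def)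
  finally show "{x \<in> \<phi> ` V. (\<pi> \<circ> \<psi>) x = 0} = \<phi> ` Z \<inter> \<phi> ` V" .
  fix W g assume W: "openin (zar Y) W" "W \<subseteq> \<phi> ` V" "g \<in> reg Y W" "\<forall>x\<in>\<phi> ` Z \<inter> W. g x = 0"
  have WY: "W \<subseteq> points Y" using W(1) by (rule openin_subset)
  \<comment> \<open>The test function \<open>g\<close> is pulled back to \<open>X\<close>, factored
    there by the given local equation, and the cofactor is carried back along
    \<open>\<psi>\<close>.\<close>
  have 1: "openin (zar X) (\<psi> ` W)" "\<psi> ` W \<subseteq> V" "g \<circ> \<phi> \<in> reg X (\<psi> ` W)"
    using inv.openin_image[OF W(1)] inv.reg_image[OF W(1,3)] image_mono[OF W(2), of \<psi>]
      image_inverse[OF VX] by auto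
  have "\<forall>x \<in> Z \<inter> \<psi> ` W. (g \<circ> \<phi>) x = 0"
    using W(4) WY inverse_right by (force simp: subset_iff)
  from local_equation_factor[OF e 1 this] obtain h
    where h: "h \<in> reg X (\<psi> ` W)" "\<And>x. x \<in> \<psi> ` W \<Longrightarrow> (g \<circ> \<phi>) x = h x * \<pi> x" by blast
  have "h \<circ> \<psi> \<in> reg Y W" using reg_image[OF 1(1) h(1)] inv.image_inverse[OF WY] by simp
  moreover have "g x = (h \<circ> \<psi>) x * (\<pi> \<circ> \<psi>) x" if "x \<in> W" for x
    using h(2)[of "\<psi> x"] that WY inverse_right[of x] by auto
  ultimately show "\<exists>h\<in>reg Y W. \<forall>x\<in>W. g x = h x * (\<pi> \<circ> \<psi>) x" by blast
qed

lemma (in space_iso) ord_along_image: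
  assumes o: "ord_along X Z f n" and Z: "Z \<subseteq> points X"
  shows "ord_along Y (\<phi> ` Z) (f \<circ> \<psi>) n"
proof -
  obtain V \<pi> u W where 1: "openin (zar X) V" "V \<inter> Z \<noteq> {}" "local_equation X Z V \<pi>"
     "u \<in> reg X V" "\<And>x. x \<in> V \<Longrightarrow> u x \<noteq> 0"
     "openin (zar X) W" "W \<noteq> {}" "W \<subseteq> V" "\<And>x. x \<in> W \<Longrightarrow> f x = u x * \<pi> x powi n"
    using o by (rule ord_alongE) (rule that)
  have sub: "V \<subseteq> points X" using 1(1) by (rule openin_subset)
  show ?thesis
  proof (rule ord_alongI)
    show "openin (zar Y) (\<phi> ` V)" "openin (zar Y) (\<phi> ` W)" using 1 openin_image by auto
    show "\<phi> ` V \<inter> \<phi> ` Z \<noteq> {}" using 1(2) by blast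
    show "local_equation Y (\<phi> ` Z) (\<phi> ` V) (\<pi> \<circ> \<psi>)" by (rule local_equation_image[OF 1(3,1) Z])
    show "u \<circ> \<psi> \<in> reg Y (\<phi> ` V)" by (rule reg_image[OF 1(1,4)])
    show "(u \<circ> \<psi>) x \<noteq> 0" if "x \<in> \<phi> ` V" for x
      using that 1(5) sub inverse_left by (auto simp: subset_iff)
    show "\<phi> ` W \<noteq> {}" "\<phi> ` W \<subseteq> \<phi> ` V" using 1(7,8) by auto
    show "(f \<circ> \<psi>) x = (u \<circ> \<psi>) x * (\<pi> \<circ> \<psi>) x powi n" if "x \<in> \<phi> ` W" for x
      using that 1(8,9) sub inverse_left by (auto simp: subset_iff)
  qed
qed

lemma (in space_iso) rational_image: "f \<in> rational_functions X \<Longrightarrow> f \<circ> \<psi> \<in> rational_functions Y"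
  unfolding rational_functions_def using openin_image reg_image by blast

lemma (in space_iso) generically_zero_imageD: "f \<circ> \<psi> \<in> generically_zero Y \<Longrightarrow> f \<in> generically_zero X"
proof -
  assume "f \<circ> \<psi> \<in> generically_zero Y"
  then obtain U where U: "openin (zar Y) U" "U \<noteq> {}" "\<forall>x\<in>U. (f \<circ> \<psi>) x = 0"
    unfolding generically_zero_def by blast
  then have "openin (zar X) (\<psi> ` U)" "\<psi> ` U \<noteq> {}" "\<forall>x\<in>\<psi> ` U. f x = 0"
    using inv.openin_image by auto
  then show ?thesis unfolding generically_zero_def by blast
qed

lemma (in space_iso) inj_on_image_prime_divisors: "inj_on ((`) \<phi>) (prime_divisors X)"
  by (rule inj_on_inverseI[of _ "(`) \<psi>"]) (simp add: image_inverse prime_divisor_subset)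

lemma (in space_iso) lookup_push_divisor:
  assumes "D \<in> divisors X" "Z \<in> prime_divisors X"
  shows "Poly_Mapping.lookup (push_divisor \<phi> D) (\<phi> ` Z) = Poly_Mapping.lookup D Z"
  unfolding push_divisor_def
  using lookup_frag_extend_inj[OF inj_on_image_prime_divisors] assms by simp

lemma (in space_iso) push_divisor_closed:
  assumes "D \<in> divisors X"
  shows "push_divisor \<phi> D \<in> divisors Y"
proof -
  have "Poly_Mapping.keys D \<subseteq> prime_divisors X" using assms by simp
  then have "Poly_Mapping.keys (push_divisor \<phi> D) \<subseteq> prime_divisors Y"
    using keys_push_divisor_subset[of \<phi> D] prime_divisor_image by blast
  then show ?thesis by simp
qed

text \<open>In general coefficients could cancel; here distinct prime divisors have distinct images,
  so every coefficient survives.\<close>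

lemma (in space_iso) keys_push_divisor:
  assumes "D \<in> divisors X"
  shows "Poly_Mapping.keys (push_divisor \<phi> D) = (`) \<phi> ` Poly_Mapping.keys D"
proof
  show "(`) \<phi> ` Poly_Mapping.keys D \<subseteq> Poly_Mapping.keys (push_divisor \<phi> D)"
  proof
    fix T assume "T \<in> (`) \<phi> ` Poly_Mapping.keys D"
    then obtain Z where Z: "T = \<phi> ` Z" "Z \<in> Poly_Mapping.keys D" by blast
    then have "Z \<in> prime_divisors X" using assms by auto
    from lookup_push_divisor[OF assms this] Z show "T \<in> Poly_Mapping.keys (push_divisor \<phi> D)"
      by (simp add: in_keys_iff)
  qed
qed (rule keys_push_divisor_subset)

lemma (in space_iso) push_divisor_inverse:
  assumes "D \<in> divisors X"
  shows "push_divisor \<psi> (push_divisor \<phi> D) = D"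
proof -
  have "push_divisor (\<psi> \<circ> \<phi>) D = push_divisor (\<lambda>x. x) D"
  proof (rule push_divisor_cong)
    fix Z x assume "Z \<in> Poly_Mapping.keys D" "x \<in> Z"
    then have "x \<in> points X" using assms prime_divisor_subset by fastforce
    then show "(\<psi> \<circ> \<phi>) x = x" by (simp add: inverse_left)
  qed
  then show ?thesis by (simp add: push_divisor_push push_divisor_id)
qed

lemma (in space_iso) principal_divisor_image:
  assumes "D \<in> principal_divisors X"
  shows "push_divisor \<phi> D \<in> principal_divisors Y"
proof -
  from assms obtain f where D: "D \<in> divisors X"
    and f: "f \<in> rational_functions X" "f \<notin> generically_zero X"
      "\<forall>Z \<in> prime_divisors X. ord_along X Z f (Poly_Mapping.lookup D Z)"
    unfolding principal_divisors_def by blast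
  have "ord_along Y T (f \<circ> \<psi>) (Poly_Mapping.lookup (push_divisor \<phi> D) T)"
    if T: "T \<in> prime_divisors Y" for T
  proof -
    have Z: "\<psi> ` T \<in> prime_divisors X" by (rule inv.prime_divisor_image[OF T])
    have TZ: "\<phi> ` \<psi> ` T = T" using T by (simp add: inv.image_inverse prime_divisor_subset)
    show ?thesis
      using ord_along_image[OF _ prime_divisor_subset[OF Z]] f(3) Z lookup_push_divisor[OF D Z]
      unfolding TZ by metis
  qed
  then show ?thesis
    using rational_image[OF f(1)] generically_zero_imageD f(2) push_divisor_closed[OF D]
    unfolding principal_divisors_def by blast
qed

lemma (in space_iso) lin_equiv_image: "lin_equiv X D E \<Longrightarrow> lin_equiv Y (push_divisor \<phi> D) (push_divisor \<phi> E)"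
  unfolding lin_equiv_def
  by (metis push_divisor_closed principal_divisor_image push_divisor_diff)

section \<open>Germs, local multiplicities and intersection numbers\<close>

lemma (in space_iso) germs_image:
  assumes "f \<in> germs X P" "P \<in> points X"
  shows "f \<circ> \<psi> \<in> germs Y (\<phi> P)"
  using assms openin_image reg_image unfolding germs_def by blast

lemma (in space_iso) germ_ideal_image:
  assumes "f \<in> germ_ideal X Z P" "Z \<subseteq> points X"
  shows "f \<circ> \<psi> \<in> germ_ideal Y (\<phi> ` Z) (\<phi> P)"
proof -
  from assms obtain U where U: "openin (zar X) U" "P \<in> U" "f \<in> reg X U" "\<forall>x\<in>U \<inter> Z. f x = 0"
    unfolding germ_ideal_def by blast
  have UX: "U \<subseteq> points X" using U(1) by (rule openin_subset)
  have "\<forall>x \<in> \<phi> ` U \<inter> \<phi> ` Z. (f \<circ> \<psi>) x = 0"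
    using U(4) inverse_left UX assms(2) unfolding image_Int_points[OF UX assms(2), symmetric]
    by (auto simp: subset_iff)
  with openin_image[OF U(1)] reg_image[OF U(1,3)] imageI[OF U(2), of \<phi>] show ?thesis
    unfolding germ_ideal_def by (intro CollectI exI[of _ "\<phi> ` U"] conjI)
qed

text \<open>A function and its transport there and back agree on points but may differ elsewhere.
  Their difference therefore need not be \<open>0\<close>, yet it lies in every ideal of germs, so
  the transport is faithful modulo these ideals.\<close>

lemma (in space_iso) vanishing_in_germ_ideal:
  assumes "\<And>x. x \<in> points X \<Longrightarrow> f x = 0" "P \<in> points X"
  shows "f \<in> germ_ideal X Z P"
proof -
  have "f \<in> reg X (points X)"
    by (rule X.reg_cong[OF X.reg_const[of _ 0]]) (auto simp: assms(1))
  then show ?thesis using assms unfolding germ_ideal_def by blast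
qed

text \<open>One inequality between the local multiplicities, phrased with spanning sets so that it
  also makes sense when no finite one exists.\<close>

lemma (in space_iso) local_mult_witness:
  assumes Z: "Z \<subseteq> points X" and T: "T \<subseteq> points X" and P: "P \<in> points X"
    and B: "\<exists>B. finite B \<and> card B = n \<and> B \<subseteq> germs X P \<and> germs X P \<subseteq>
      fun_span (B \<union> {f + g | f g. f \<in> germ_ideal X Z P \<and> g \<in> germ_ideal X T P})"
  shows "\<exists>m\<le>n. \<exists>B. finite B \<and> card B = m \<and> B \<subseteq> germs Y (\<phi> P) \<and> germs Y (\<phi> P) \<subseteq>
      fun_span (B \<union> {f + g | f g. f \<in> germ_ideal Y (\<phi> ` Z) (\<phi> P) \<and> g \<in> germ_ideal Y (\<phi> ` T) (\<phi> P)})"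
proof (rule quot_dim_comp[OF _ _ _ B, where \<phi> = \<psi>])
  show "g \<circ> \<psi> \<in> germs Y (\<phi> P)" if "g \<in> germs X P" for g
    using germs_image[OF that P] .
  show "k \<circ> \<psi> \<in> {f + g | f g. f \<in> germ_ideal Y (\<phi> ` Z) (\<phi> P) \<and> g \<in> germ_ideal Y (\<phi> ` T) (\<phi> P)}"
    if "k \<in> {f + g | f g. f \<in> germ_ideal X Z P \<and> g \<in> germ_ideal X T P}" for k
  proof -
    from that obtain f g where k: "k = f + g" "f \<in> germ_ideal X Z P" "g \<in> germ_ideal X T P" by blast
    have "k \<circ> \<psi> = (f \<circ> \<psi>) + (g \<circ> \<psi>)" using k(1) by auto
    then show ?thesis using germ_ideal_image[OF k(2) Z] germ_ideal_image[OF k(3) T] by blast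
  qed
  show "\<exists>g\<in>germs X P. f - (g \<circ> \<psi>) \<in> {f + g | f g. f \<in> germ_ideal Y (\<phi> ` Z) (\<phi> P) \<and> g \<in> germ_ideal Y (\<phi> ` T) (\<phi> P)}"
    if f: "f \<in> germs Y (\<phi> P)" for f
  proof
    show "f \<circ> \<phi> \<in> germs X P"
      using inv.germs_image[OF f map_points[OF P]] inverse_left[OF P] by simp
    have "f - (f \<circ> \<phi> \<circ> \<psi>) \<in> germ_ideal Y (\<phi> ` Z) (\<phi> P)"
      by (rule inv.vanishing_in_germ_ideal) (auto simp: inverse_right map_points P)
    moreover have "0 \<in> germ_ideal Y (\<phi> ` T) (\<phi> P)"
      by (rule inv.vanishing_in_germ_ideal) (auto simp: map_points P)
    moreover have "f - (f \<circ> \<phi> \<circ> \<psi>) = (f - (f \<circ> \<phi> \<circ> \<psi>)) + 0" by simp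
    ultimately show "f - (f \<circ> \<phi> \<circ> \<psi>) \<in>
        {f + g | f g. f \<in> germ_ideal Y (\<phi> ` Z) (\<phi> P) \<and> g \<in> germ_ideal Y (\<phi> ` T) (\<phi> P)}"
      by blast
  qed
qed

lemma (in space_iso) local_mult_image:
  assumes Z: "Z \<subseteq> points X" and T: "T \<subseteq> points X" and P: "P \<in> points X"
  shows "local_mult Y (\<phi> ` Z) (\<phi> ` T) (\<phi> P) = local_mult X Z T P"
  unfolding local_mult_def quot_dim_def
proof (rule Least_eq_mutual)
  fix n
  assume B: "\<exists>B. finite B \<and> card B = n \<and> B \<subseteq> germs Y (\<phi> P) \<and> germs Y (\<phi> P) \<subseteq>
      fun_span (B \<union> {f + g | f g. f \<in> germ_ideal Y (\<phi> ` Z) (\<phi> P) \<and> g \<in> germ_ideal Y (\<phi> ` T) (\<phi> P)})"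
  show "\<exists>m\<le>n. \<exists>B. finite B \<and> card B = m \<and> B \<subseteq> germs X P \<and> germs X P \<subseteq>
      fun_span (B \<union> {f + g | f g. f \<in> germ_ideal X Z P \<and> g \<in> germ_ideal X T P})"
    using inv.local_mult_witness[OF image_points[OF Z] image_points[OF T] map_points[OF P] B]
    unfolding image_inverse[OF Z] image_inverse[OF T] inverse_left[OF P] .
qed (rule local_mult_witness[OF assms])

lemma (in space_iso) proper_intersection_image:
  assumes D: "D \<in> divisors X" and E: "E \<in> divisors X"
  shows "proper_intersection Y (push_divisor \<phi> D) (push_divisor \<phi> E) = proper_intersection X D E"
proof -
  have k: "Poly_Mapping.keys D \<subseteq> prime_divisors X" "Poly_Mapping.keys E \<subseteq> prime_divisors X"
    using D E by auto
  have inj: "inj_on ((`) \<phi>) (Poly_Mapping.keys D)" "inj_on ((`) \<phi>) (Poly_Mapping.keys E)"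
    using inj_on_image_prime_divisors k by (blast intro: inj_on_subset)+
  have loc: "(\<Sum>P \<in> \<phi> ` Z \<inter> \<phi> ` T. int (local_mult Y (\<phi> ` Z) (\<phi> ` T) P)) =
      (\<Sum>P \<in> Z \<inter> T. int (local_mult X Z T P))"
    if "Z \<in> Poly_Mapping.keys D" "T \<in> Poly_Mapping.keys E" for Z T
  proof -
    have Z: "Z \<subseteq> points X" and T: "T \<subseteq> points X" using that k prime_divisor_subset by blast+
    \<comment> \<open>Reindexing along an injective map also covers an infinite intersection, for
      which both sums are 0 by convention.\<close>
    have "inj_on \<phi> (Z \<inter> T)" using inj_on_points Z by (blast intro: inj_on_subset)
    then show ?thesis
      unfolding image_Int_points[OF Z T, symmetric]
      using Z by (auto simp: sum.reindex local_mult_image[OF Z T] subset_iff intro!: sum.cong)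
  qed
  show ?thesis
    unfolding proper_intersection_def keys_push_divisor[OF D] keys_push_divisor[OF E]
      sum.reindex[OF inj(1)] sum.reindex[OF inj(2)] comp_def
  proof (intro sum.cong refl)
    fix Z T assume ZT: "Z \<in> Poly_Mapping.keys D" "T \<in> Poly_Mapping.keys E"
    then have "Z \<in> prime_divisors X" "T \<in> prime_divisors X" using k by auto
    then show "Poly_Mapping.lookup (push_divisor \<phi> D) (\<phi> ` Z) * Poly_Mapping.lookup (push_divisor \<phi> E) (\<phi> ` T) *
        (\<Sum>P \<in> \<phi> ` Z \<inter> \<phi> ` T. int (local_mult Y (\<phi> ` Z) (\<phi> ` T) P)) =
      Poly_Mapping.lookup D Z * Poly_Mapping.lookup E T * (\<Sum>P \<in> Z \<inter> T. int (local_mult X Z T P))"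
      by (simp only: lookup_push_divisor[OF D] lookup_push_divisor[OF E] loc[OF ZT])
  qed
qed

lemma (in space_iso) intersection_witness:
  assumes "\<exists>D' E'. lin_equiv X D D' \<and> lin_equiv X E E' \<and>
     Poly_Mapping.keys D' \<inter> Poly_Mapping.keys E' = {} \<and> n = proper_intersection X D' E'"
  shows "\<exists>D' E'. lin_equiv Y (push_divisor \<phi> D) D' \<and> lin_equiv Y (push_divisor \<phi> E) E' \<and>
     Poly_Mapping.keys D' \<inter> Poly_Mapping.keys E' = {} \<and> n = proper_intersection Y D' E'"
proof -
  from assms obtain D' E' where 1: "lin_equiv X D D'" "lin_equiv X E E'"
    "Poly_Mapping.keys D' \<inter> Poly_Mapping.keys E' = {}" "n = proper_intersection X D' E'" by blast
  have D': "D' \<in> divisors X" and E': "E' \<in> divisors X" using 1 by (simp_all add: lin_equiv_def)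
  then have k: "Poly_Mapping.keys D' \<subseteq> prime_divisors X" "Poly_Mapping.keys E' \<subseteq> prime_divisors X" by auto
  have "Poly_Mapping.keys (push_divisor \<phi> D') \<inter> Poly_Mapping.keys (push_divisor \<phi> E') = {}"
    unfolding keys_push_divisor[OF D'] keys_push_divisor[OF E']
    using inj_on_image_Int[OF inj_on_image_prime_divisors k] 1(3) by simp
  then show ?thesis
    using lin_equiv_image[OF 1(1)] lin_equiv_image[OF 1(2)] 1(4) proper_intersection_image[OF D' E']
    by metis
qed

text \<open>The predicates under \<open>THE\<close> are equivalent, so the described values agree
  whether or not suitable moved divisors exist or give a unique number.\<close>

lemma (in space_iso) intersection_number_image:
  assumes D: "D \<in> divisors X" and E: "E \<in> divisors X"
  shows "intersection_number Y (push_divisor \<phi> D) (push_divisor \<phi> E) = intersection_number X D E"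
proof -
  have "(\<exists>D' E'. lin_equiv Y (push_divisor \<phi> D) D' \<and> lin_equiv Y (push_divisor \<phi> E) E' \<and>
      Poly_Mapping.keys D' \<inter> Poly_Mapping.keys E' = {} \<and> n = proper_intersection Y D' E') \<longleftrightarrow>
    (\<exists>D' E'. lin_equiv X D D' \<and> lin_equiv X E E' \<and>
      Poly_Mapping.keys D' \<inter> Poly_Mapping.keys E' = {} \<and> n = proper_intersection X D' E')" for n
    using intersection_witness[of D E n]
      inv.intersection_witness[of "push_divisor \<phi> D" "push_divisor \<phi> E" n]
    unfolding push_divisor_inverse[OF D] push_divisor_inverse[OF E] by blast
  then show ?thesis unfolding intersection_number_def by simp
qed

lemma (in space_iso) push_divisor_iso: "push_divisor \<phi> \<in> iso (div_group X) (div_group Y)"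
proof (rule isoI)
  show "push_divisor \<phi> \<in> hom (div_group X) (div_group Y)"
    by (rule homI) (simp_all add: push_divisor_add push_divisor_closed del: carrier_free_Abelian_group_iff)
  show "bij_betw (push_divisor \<phi>) (divisors X) (divisors Y)"
    by (rule bij_betwI[where g = "push_divisor \<psi>"])
       (auto simp: push_divisor_closed inv.push_divisor_closed push_divisor_inverse
         inv.push_divisor_inverse simp del: carrier_free_Abelian_group_iff)
qed

subsection \<open>Invariance of the refined Humbert invariant\<close>

text \<open>Applied twice, to divisors modulo \<open>pic0_divisors\<close> and to NS modulo the
  multiples of the polarization. Taking direct images of cosets makes the induced map on
  NS/Z\<theta> a twice iterated image of \<open>push_divisor\<close>, which is the shape in which
  \<open>q_tilde\<close> is transported.\<close>

lemma image_iso_FactGroup: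
  assumes g: "g \<in> iso G H" and G: "Group.group G" and N: "N \<lhd> G"
  shows "(`) g \<in> iso (G Mod N) (H Mod (g ` N))"
proof (rule isoI)
  have hom: "\<And>x y. x \<in> carrier G \<Longrightarrow> y \<in> carrier G \<Longrightarrow> g (x \<otimes>\<^bsub>G\<^esub> y) = g x \<otimes>\<^bsub>H\<^esub> g y"
    and bij: "bij_betw g (carrier G) (carrier H)"
    using g by (auto simp: iso_def hom_def)
  have NG: "N \<subseteq> carrier G" using N by (meson normal_def subgroup.subset)
  have coset: "g ` (N #>\<^bsub>G\<^esub> a) = g ` N #>\<^bsub>H\<^esub> g a" if "a \<in> carrier G" for a
    using that NG hom unfolding r_coset_def by (auto simp: image_UN subset_iff)
  have sub: "K \<subseteq> carrier G" if "K \<in> carrier (G Mod N)" for K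
    using that monoid.r_coset_subset_G[OF group.is_monoid[OF G] NG] by (auto simp: carrier_FactGroup)
  have surj: "(`) g ` carrier (G Mod N) = carrier (H Mod (g ` N))"
  proof -
    have "(`) g ` carrier (G Mod N) = (\<lambda>a. g ` N #>\<^bsub>H\<^esub> g a) ` carrier G"
      by (simp add: carrier_FactGroup image_image coset cong: image_cong)
    also have "\<dots> = carrier (H Mod (g ` N))"
      using bij by (simp add: carrier_FactGroup bij_betw_def image_image[symmetric])
    finally show ?thesis .
  qed
  show "(`) g \<in> hom (G Mod N) (H Mod (g ` N))"
  proof (rule homI)
    fix K L assume KL: "K \<in> carrier (G Mod N)" "L \<in> carrier (G Mod N)"
    show "g ` K \<in> carrier (H Mod (g ` N))" using surj KL by blast
    have "g ` (K <#>\<^bsub>G\<^esub> L) = g ` K <#>\<^bsub>H\<^esub> g ` L"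
      using sub[OF KL(1)] sub[OF KL(2)] hom unfolding set_mult_def
      by (auto simp: image_UN subset_iff)
    then show "g ` (K \<otimes>\<^bsub>G Mod N\<^esub> L) = g ` K \<otimes>\<^bsub>H Mod (g ` N)\<^esub> g ` L" by simp
  qed
  have "inj_on ((`) g) (Pow (carrier G))"
    using bij by (intro inj_on_image_Pow) (simp add: bij_betw_def)
  then have "inj_on ((`) g) (carrier (G Mod N))"
    by (rule inj_on_subset) (use sub in blast)
  then show "bij_betw ((`) g) (carrier (G Mod N)) (carrier (H Mod (g ` N)))"
    using surj by (simp add: bij_betw_def)
qed

section \<open>Isomorphisms of polarized abelian surfaces\<close>

locale group_space_iso = space_iso "avar J" "avar A" \<phi> \<psi> + J: Group.group J + A: Group.group A
  for J A :: "'k::field pt monoid" and \<phi> \<psi> +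
  assumes hom: "\<phi> \<in> hom J A"
begin

lemma inverse_hom: "\<psi> \<in> hom A J"
proof (rule homI)
  fix x y assume x: "x \<in> carrier A" and y: "y \<in> carrier A"
  have c: "\<psi> x \<in> carrier J" "\<psi> y \<in> carrier J" using x y inv.map_points by auto
  show "\<psi> x \<in> carrier J" by (rule c)
  have "\<phi> (\<psi> x \<otimes>\<^bsub>J\<^esub> \<psi> y) = x \<otimes>\<^bsub>A\<^esub> y"
    using hom_mult[OF hom c] inverse_right x y by simp
  then show "\<psi> (x \<otimes>\<^bsub>A\<^esub> y) = \<psi> x \<otimes>\<^bsub>J\<^esub> \<psi> y"
    using inverse_left[of "\<psi> x \<otimes>\<^bsub>J\<^esub> \<psi> y"] c by simp
qed

lemma group_sym: "group_space_iso A J \<psi> \<phi>"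
  by (simp add: group_space_iso_def group_space_iso_axioms_def sym J.group_axioms A.group_axioms inverse_hom)

lemma translate_pullback_image:
  assumes a: "a \<in> carrier J" and D: "D \<in> divisors (avar J)"
  shows "translate_pullback A (\<phi> a) (push_divisor \<phi> D) = push_divisor \<phi> (translate_pullback J a D)"
  unfolding translate_pullback_def push_divisor_push
proof (rule push_divisor_cong)
  interpret group_hom J A \<phi> 
    by (simp add: group_hom_def group_hom_axioms_def J.group_axioms A.group_axioms hom)
  fix Z x assume "Z \<in> Poly_Mapping.keys D" "x \<in> Z"
  then have "x \<in> carrier J" using D prime_divisor_subset by fastforce
  then show "((\<lambda>x. inv\<^bsub>A\<^esub> \<phi> a \<otimes>\<^bsub>A\<^esub> x) \<circ> \<phi>) x = (\<phi> \<circ> (\<lambda>x. inv\<^bsub>J\<^esub> a \<otimes>\<^bsub>J\<^esub> x)) x"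
    using a by simp
qed

lemma pic0_divisors_image:
  assumes D: "D \<in> pic0_divisors J"
  shows "push_divisor \<phi> D \<in> pic0_divisors A"
proof -
  have div: "D \<in> divisors (avar J)" using D unfolding pic0_divisors_def by blast
  have "lin_equiv (avar A) (translate_pullback A b (push_divisor \<phi> D)) (push_divisor \<phi> D)"
    if b: "b \<in> carrier A" for b
  proof -
    have a: "\<psi> b \<in> carrier J" "\<phi> (\<psi> b) = b" using b inv.map_points inverse_right by auto
    have "lin_equiv (avar J) (translate_pullback J (\<psi> b) D) D"
      using D a unfolding pic0_divisors_def by blast
    from lin_equiv_image[OF this] show ?thesis
      using translate_pullback_image[OF a(1) div] a(2) by simp
  qed
  then show ?thesis using push_divisor_closed[OF div] unfolding pic0_divisors_def by blast
qed

end

sublocale group_space_iso \<subseteq> ginv: group_space_iso A J \<psi> \<phi>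
  by (rule group_sym)

lemma (in group_space_iso) image_pic0_divisors: "push_divisor \<phi> ` pic0_divisors J = pic0_divisors A"
proof
  show "pic0_divisors A \<subseteq> push_divisor \<phi> ` pic0_divisors J"
  proof
    fix E assume E: "E \<in> pic0_divisors A"
    then have "E \<in> divisors (avar A)" unfolding pic0_divisors_def by blast
    then show "E \<in> push_divisor \<phi> ` pic0_divisors J"
      using ginv.pic0_divisors_image[OF E] inv.push_divisor_inverse by (metis imageI)
  qed
qed (use pic0_divisors_image in blast)

lemma NS_subset_divisors:
  assumes "c \<in> carrier (NS A)"
  shows "c \<subseteq> divisors (avar A)"
proof -
  have "pic0_divisors A \<subseteq> divisors (avar A)" unfolding pic0_divisors_def by blast
  from monoid.r_coset_subset_G[OF group.is_monoid[OF group_free_Abelian_group] this] assms show ?thesis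
    unfolding NS_def carrier_FactGroup by blast
qed

text \<open>The sets under \<open>the_elem\<close> are shown to be equal, so the values agree even
  if these sets are not singletons.\<close>

lemma (in group_space_iso) ns_intersection_image:
  assumes "c \<subseteq> divisors (avar J)" "d \<subseteq> divisors (avar J)"
  shows "ns_intersection A (push_divisor \<phi> ` c) (push_divisor \<phi> ` d) = ns_intersection J c d"
proof -
  have eq: "intersection_number (avar A) (push_divisor \<phi> D) (push_divisor \<phi> E)
      = intersection_number (avar J) D E" if "D \<in> c" "E \<in> d" for D E
    using assms that by (intro intersection_number_image) blast+
  have "{intersection_number (avar A) D E | D E. D \<in> push_divisor \<phi> ` c \<and> E \<in> push_divisor \<phi> ` d}
      = {intersection_number (avar J) D E | D E. D \<in> c \<and> E \<in> d}" (is "?L = ?R")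
  proof
    show "?L \<subseteq> ?R" using eq by blast
    show "?R \<subseteq> ?L"
    proof
      fix n assume "n \<in> ?R"
      then obtain D E where "D \<in> c" "E \<in> d" "n = intersection_number (avar J) D E" by blast
      with eq[of D E] show "n \<in> ?L"
        by (intro CollectI exI[of _ "push_divisor \<phi> D"] exI[of _ "push_divisor \<phi> E"]) simp
    qed
  qed
  then show ?thesis unfolding ns_intersection_def by (rule arg_cong)
qed

lemma (in group_space_iso) q_tilde_image:
  assumes "c \<subseteq> divisors (avar J)" "\<theta> \<subseteq> divisors (avar J)"
  shows "q_tilde A (push_divisor \<phi> ` \<theta>) (push_divisor \<phi> ` c) = q_tilde J \<theta> c"
  by (simp add: q_tilde_def ns_intersection_image assms)

text \<open>The isomorphism of divisor groups descends to NS and then to NS/Z\<theta>, because it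
  matches \<open>pic0_divisors\<close> and the subgroups generated by the polarizations. Hence
  \<open>g\<close> is the image of some \<open>h\<close>, and \<open>q_tilde\<close> takes the same
  values on the two cosets.\<close>

lemma (in group_space_iso) q_induced_image:
  assumes J: "ppas J \<theta>" and A: "ppas A \<eta>" and \<eta>: "push_divisor \<phi> ` \<theta> = \<eta>"
    and g: "g \<in> carrier (NS_mod_theta A \<eta>)"
  shows "\<exists>h \<in> carrier (NS_mod_theta J \<theta>). q_induced J \<theta> h = q_induced A \<eta> g"
proof -
  let ?P = "(`) (push_divisor \<phi>)"
  interpret NJ: comm_group "NS J" using J by (rule comm_group_NS)
  interpret NA: comm_group "NS A" using A by (rule comm_group_NS)
  interpret DJ: comm_group "div_group (avar J)" by (rule abelian_free_Abelian_group)
  have "pic0_divisors J \<lhd> div_group (avar J)"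
    using subgroup_pic0_divisors[OF J] by (simp add: DJ.normal_iff_subgroup)
  from image_iso_FactGroup[OF push_divisor_iso group_free_Abelian_group this]
  have P: "?P \<in> iso (NS J) (NS A)"
    by (simp add: NS_def image_pic0_divisors)
  have "?P \<in> hom (NS J) (NS A)" using P by (simp add: iso_def)
  then interpret P: group_hom "NS J" "NS A" ?P
    by (simp add: group_hom_def group_hom_axioms_def NJ.group_axioms NA.group_axioms)
  have gen: "?P ` generate (NS J) {\<theta>} = generate (NS A) {\<eta>}"
    using P.generate_img[of "{\<theta>}"] theta_in_NS[OF J] \<eta> by simp
  have "generate (NS J) {\<theta>} \<lhd> NS J"
    using subgroup_generate_theta[OF J] by (simp add: NJ.normal_iff_subgroup)
  from image_iso_FactGroup[OF P NJ.group_axioms this]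
  have "(`) ?P \<in> iso (NS_mod_theta J \<theta>) (NS_mod_theta A \<eta>)"
    by (simp add: NS_mod_theta_def gen)
  then have "(`) ?P ` carrier (NS_mod_theta J \<theta>) = carrier (NS_mod_theta A \<eta>)"
    by (simp add: iso_iff)
  then have "g \<in> (`) ?P ` carrier (NS_mod_theta J \<theta>)" using g by simp
  then obtain h where h: "h \<in> carrier (NS_mod_theta J \<theta>)" "g = ?P ` h" by (rule imageE) (rule that)
  \<comment> \<open>The members of \<open>h\<close> are classes in NS, and these consist of
    divisors, as the transport of \<open>q_tilde\<close> requires.\<close>
  have "h \<subseteq> carrier (NS J)"
    using h(1) NJ.r_coset_subset_G[OF subgroup.subset[OF subgroup_generate_theta[OF J]]]
    unfolding NS_mod_theta_def carrier_FactGroup by blast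
  then have "q_tilde A \<eta> (?P c) = q_tilde J \<theta> c" if "c \<in> h" for c
    using that NS_subset_divisors theta_in_NS[OF J] unfolding \<eta>[symmetric]
    by (intro q_tilde_image) blast+
  then have "q_tilde A \<eta> ` g = q_tilde J \<theta> ` h"
    unfolding h(2) image_image by (rule image_cong[OF refl])
  then show ?thesis using h(1) unfolding q_induced_def by metis
qed

text \<open>Puts a surface into its own class; an equality of classes then yields an actual
  isomorphism.\<close>

lemma ppas_iso_refl:
  assumes "ppas A \<theta>"
  shows "((A, \<theta>), (A, \<theta>)) \<in> ppas_iso"
proof -
  have "morphism (avar A) (avar A) (\<lambda>x. x)"
    unfolding morphism_def
  proof (intro conjI allI impI)
    fix U f assume U: "openin (zar (avar A)) U \<and> f \<in> reg (avar A) U"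
    then have "{x \<in> points (avar A). x \<in> U} = U" using openin_subset by blast
    then show "f \<circ> (\<lambda>x. x) \<in> reg (avar A) {x \<in> points (avar A). x \<in> U}"
      using U by (simp add: comp_def)
  qed simp
  then have "isomorphism (avar A) (avar A) (\<lambda>x. x)" unfolding isomorphism_def by blast
  moreover have "(\<lambda>x. x) \<in> hom A A" by (simp add: hom_def)
  moreover have "push_divisor (\<lambda>x. x) ` \<theta> = \<theta>" by (simp add: push_divisor_id)
  ultimately show ?thesis using assms unfolding ppas_iso_def by blast
qed

lemma q_induced_moduli_class:
  assumes J: "ppas J \<theta>" and A: "ppas A \<eta>" and eq: "moduli_class J \<theta> = moduli_class A \<eta>"
    and g: "g \<in> carrier (NS_mod_theta A \<eta>)"
  shows "\<exists>h \<in> carrier (NS_mod_theta J \<theta>). q_induced J \<theta> h = q_induced A \<eta> g"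
proof -
  have "(A, \<eta>) \<in> moduli_class J \<theta>"
    using ppas_iso_refl[OF A] unfolding eq by (simp add: moduli_class_def)
  then obtain \<phi> where \<phi>: "isomorphism (avar J) (avar A) \<phi>" "\<phi> \<in> hom J A" "push_divisor \<phi> ` \<theta> = \<eta>"
    by (auto simp: moduli_class_def ppas_iso_def)
  from \<phi>(1) obtain \<psi> where "morphism (avar J) (avar A) \<phi>" "morphism (avar A) (avar J) \<psi>"
    "\<forall>x \<in> carrier J. \<psi> (\<phi> x) = x" "\<forall>y \<in> carrier A. \<phi> (\<psi> y) = y"
    unfolding isomorphism_def points_var by blast
  then have "space_iso (avar J) (avar A) \<phi> \<psi>"
    by (simp add: space_iso_def space_iso_axioms_def function_space_var)
  then have "group_space_iso J A \<phi> \<psi>"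
    using J A \<phi>(2)
    by (simp add: group_space_iso_def group_space_iso_axioms_def ppas_def abelian_variety_def)
  from group_space_iso.q_induced_image[OF this J A \<phi>(3) g] show ?thesis .
qed

subsection \<open>Representations by forms\<close>

lemma form_equiv_represents:
  assumes "Q \<sim>\<^sub>Z Q'" "represents Q' N"
  shows "represents Q N"
proof -
  obtain U where n: "fst Q = fst Q'" and U: "U \<in> carrier_mat (fst Q) (fst Q)" "invertible_mat U"
    and q: "\<forall>x \<in> carrier_vec (fst Q). snd Q x = snd Q' (U *\<^sub>v x)"
    using assms(1) unfolding form_equiv_def by blast
  obtain V where V: "inverts_mat U V" "inverts_mat V U" using U(2) unfolding invertible_mat_def by blast
  \<comment> \<open>\<open>invertible_mat\<close> does not state the size of the inverse; it is read
    off from the two products \<open>U * V\<close> and \<open>V * U\<close>. The entries of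
    \<open>V\<close> are integers by type.\<close>
  have "V \<in> carrier_mat (fst Q) (fst Q)"
  proof
    show "dim_row V = fst Q" "dim_col V = fst Q"
      using V U(1) unfolding inverts_mat_def
      by (metis carrier_matD index_mult_mat(2,3) index_one_mat(2,3))+
  qed
  moreover obtain y where y: "y \<in> carrier_vec (fst Q)" "snd Q' y = N"
    using assms(2) n unfolding represents_def by auto
  ultimately have "V *\<^sub>v y \<in> carrier_vec (fst Q)" "U *\<^sub>v (V *\<^sub>v y) = y"
    using U V unfolding inverts_mat_def
    by (auto simp: assoc_mult_mat_vec[symmetric])
  then show ?thesis using q y unfolding represents_def by metis
qed

text \<open>A vector is turned into an element of NS/Z\<eta> by the basis \<open>b\<close>, this
  element is replaced by one of NS/Z\<theta> with the same value, and the basis \<open>c\<close>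
  turns it back into a vector. The path preserves the value but says nothing about
  primitivity.\<close>

lemma refined_humbert_represents_transfer:
  assumes J: "ppas J \<theta>" and A: "ppas A \<eta>" and eq: "moduli_class J \<theta> = moduli_class A \<eta>"
    and R: "R \<in> refined_humbert J \<theta>" and Q: "Q \<in> refined_humbert A \<eta>" and rep: "represents Q N"
  shows "represents R N"
proof -
  obtain n b where b: "z_basis (NS_mod_theta A \<eta>) n b"
    "Q \<sim>\<^sub>Z (n, \<lambda>x. q_induced A \<eta> (int_comb (NS_mod_theta A \<eta>) n b x))"
    using Q unfolding refined_humbert_def by blast
  obtain m c where c: "z_basis (NS_mod_theta J \<theta>) m c"
    "R \<sim>\<^sub>Z (m, \<lambda>x. q_induced J \<theta> (int_comb (NS_mod_theta J \<theta>) m c x))"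
    using R unfolding refined_humbert_def by blast
  obtain x where "q_induced A \<eta> (int_comb (NS_mod_theta A \<eta>) n b x) = N"
    using rep b(2) unfolding represents_def form_equiv_def by auto
  moreover have "int_comb (NS_mod_theta A \<eta>) n b x \<in> carrier (NS_mod_theta A \<eta>)"
    using b(1) by (intro comm_group.int_comb_closed comm_group_NS_mod_theta[OF A]) (simp add: z_basis_def)
  ultimately obtain h where h: "h \<in> carrier (NS_mod_theta J \<theta>)" "q_induced J \<theta> h = N"
    using q_induced_moduli_class[OF J A eq] by metis
  obtain y where "y \<in> carrier_vec m" "h = int_comb (NS_mod_theta J \<theta>) m c y"
    using c(1) h(1) unfolding z_basis_def by blast
  then have "represents (m, \<lambda>x. q_induced J \<theta> (int_comb (NS_mod_theta J \<theta>) m c x)) N"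
    using h(2) unfolding represents_def by auto
  then show ?thesis by (rule form_equiv_represents[OF c(2)])
qed

lemma represents_scale_form: "c \<noteq> 0 \<Longrightarrow> represents (scale_form c Q) (c * N) \<longleftrightarrow> represents Q N"
  by (simp add: represents_def scale_form_def)

lemma prim_represents_imp_represents: "prim_represents Q N \<Longrightarrow> represents Q N"
  unfolding prim_represents_def represents_def by blast

lemma represents_ternary_form_iff:
  "represents (ternary_form a b c r s t) N \<longleftrightarrow>
     (\<exists>x y z. a * x^2 + b * y^2 + c * z^2 + r * y * z + s * x * z + t * x * y = N)"
proof
  assume "\<exists>x y z. a * x^2 + b * y^2 + c * z^2 + r * y * z + s * x * z + t * x * y = N"
  then obtain x y z where N: "a * x^2 + b * y^2 + c * z^2 + r * y * z + s * x * z + t * x * y = N"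
    by blast
  show "represents (ternary_form a b c r s t) N"
    unfolding represents_def ternary_form_def
    by (rule bexI[of _ "vec 3 (\<lambda>i. if i = 0 then x else if i = 1 then y else z)"])
       (use N in \<open>auto simp: Let_def\<close>)
qed (auto simp: represents_def ternary_form_def Let_def)

lemma represents_ternary_form_square:
  assumes "represents (ternary_form a b c r s t) N"
  shows "represents (ternary_form a b c r s t) (k^2 * N)"
proof -
  obtain x y z where N: "a * x^2 + b * y^2 + c * z^2 + r * y * z + s * x * z + t * x * y = N"
    using assms unfolding represents_ternary_form_iff by blast
  have "a * (k * x)^2 + b * (k * y)^2 + c * (k * z)^2 + r * (k * y) * (k * z)
      + s * (k * x) * (k * z) + t * (k * x) * (k * y) = k^2 * N"
    unfolding N[symmetric] by (simp add: algebra_simps power2_eq_square)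
  then show ?thesis unfolding represents_ternary_form_iff by blast
qed

text \<open>A form is homogeneous of degree 2, so the square of the gcd of the coordinates divides
  the value. A square-free value forces this gcd to be a unit, and the gcd of integers is normalized
  to be nonnegative.\<close>

lemma represents_squarefree_imp_prim_represents:
  assumes rep: "represents (ternary_form a b c r s t) N" and N: "squarefree N"
  shows "prim_represents (ternary_form a b c r s t) N"
proof -
  obtain v where v: "v \<in> carrier_vec 3" "snd (ternary_form a b c r s t) v = N"
    using rep unfolding represents_def by (auto simp: ternary_form_def)
  let ?S = "(\<lambda>i. v $ i) ` {..<3::nat}"
  let ?g = "Gcd ?S"
  have "?g dvd v $ 0" "?g dvd v $ 1" "?g dvd v $ 2" by (auto intro!: Gcd_dvd)
  then obtain x y z where xyz: "v $ 0 = ?g * x" "v $ 1 = ?g * y" "v $ 2 = ?g * z"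
    unfolding dvd_def by blast
  have "N = ?g^2 * (a * x^2 + b * y^2 + c * z^2 + r * y * z + s * x * z + t * x * y)"
    using v(2) unfolding ternary_form_def Let_def snd_conv xyz
    by (simp add: algebra_simps power2_eq_square)
  then have "?g^2 dvd N" by (metis dvd_triv_left)
  then have "is_unit ?g" using N by (rule squarefreeD[rotated])
  moreover have "?g \<ge> 0" by (rule Gcd_int_greater_eq_0)
  ultimately have "?g = 1" unfolding zdvd1_eq by linarith
  then show ?thesis
    unfolding prim_represents_def using v by (intro bexI[of _ v]) (simp_all add: ternary_form_def)
qed

lemma prim_represents_scale_form:
  "prim_represents Q N \<Longrightarrow> prim_represents (scale_form c Q) (c * N)"
  unfolding prim_represents_def scale_form_def by auto

lemma squarefree_int:
  assumes "squarefree n"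
  shows "squarefree (int n)"
proof (rule squarefreeI)
  fix x assume "x^2 dvd int n"
  moreover have "x^2 = int ((nat \<bar>x\<bar>)^2)" by simp
  ultimately have "(nat \<bar>x\<bar>)^2 dvd n" by (metis int_dvd_int_iff)
  then have "nat \<bar>x\<bar> dvd 1" using assms by (rule squarefreeD[rotated])
  then show "is_unit x" by simp
qed

lemma squarefree_decomposition_nat:
  fixes n :: nat
  assumes "n > 0"
  obtains k m where "n = k^2 * m" "squarefree m"
proof
  show "n = square_part n ^ 2 * squarefree_part n"
    by (simp add: squarefree_decompose[symmetric] mult.commute)
  show "squarefree (squarefree_part n)" using assms by simp
qed

theorem mainTheorem3:
  fixes C :: "'k::{alg_closed_field, field_char_0} pt set"
    and J :: "'k pt monoid"
    and \<theta> :: "'k pt divisor set"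
    and f' :: qform
  defines "f' \<equiv> ternary_form 1 3 7 0 1 1"
  assumes "smooth_curve C" and "genus C = 2"
    and "polarized_jacobian C J \<theta>"
    and "scale_form 4 f' \<in> refined_humbert J \<theta>"
  shows "(\<forall>N>0. odd N \<longrightarrow> represents f' N) \<longleftrightarrow> moduli_class J \<theta> \<in> humbert_infinity"
proof
  have J: "ppas J \<theta>" using assms(4) by (simp add: polarized_jacobian_def)
  {
    assume rep: "\<forall>N>0. odd N \<longrightarrow> represents f' N"
    have "moduli_class J \<theta> \<in> humbert_surface (4 * N)" if N: "N > 0" "odd N" "squarefree N" for N
    proof -
      have "represents f' (int N)" using rep N by simp
      then have "prim_represents f' (int N)"
        unfolding f'_def by (rule represents_squarefree_imp_prim_represents) (rule squarefree_int[OF N(3)])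
      then have "prim_represents (scale_form 4 f') (int (4 * N))"
        using prim_represents_scale_form[of f' "int N" 4] by simp
      moreover have "moduli_class J \<theta> \<in> moduli_A2"
        unfolding moduli_class_def moduli_A2_def using J by (intro quotientI) simp
      \<comment> \<open>\<open>(J, \<theta>)\<close> itself represents its class, and
        \<open>scale_form 4 f'\<close> is the form of its invariant that gives the primitive
        representation.\<close>
      ultimately show ?thesis using J assms(5) unfolding humbert_surface_def by blast
    qed
    then show "moduli_class J \<theta> \<in> humbert_infinity" by (simp add: humbert_infinity_def)
  }
  assume H: "moduli_class J \<theta> \<in> humbert_infinity"
  show "\<forall>N>0. odd N \<longrightarrow> represents f' N"
  proof (intro allI impI)
    fix N :: int assume N: "N > 0" "odd N"
    obtain k m where km: "nat N = k^2 * m" "squarefree m"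
      using squarefree_decomposition_nat[of "nat N"] N(1) by auto
    have Nkm: "N = (int k)^2 * int m" using km(1) N(1) by (metis int_nat_eq of_nat_mult of_nat_power order_less_imp_le)
    \<comment> \<open>An even \<open>m\<close> would make \<open>N\<close> even and
      \<open>m = 0\<close> would make it 0; an index of \<open>humbert_infinity\<close> has to be
      odd and positive.\<close>
    have m: "m > 0" "odd m" using N Nkm by (auto intro: gr0I)
    then have "moduli_class J \<theta> \<in> humbert_surface (4 * m)"
      using H km(2) by (simp add: humbert_infinity_def)
    then obtain A \<eta> Q where A: "moduli_class J \<theta> = moduli_class A \<eta>" "ppas A \<eta>"
      "Q \<in> refined_humbert A \<eta>" "prim_represents Q (int (4 * m))"
      unfolding humbert_surface_def by blast
    \<comment> \<open>Primitivity is forgotten before the transfer to \<open>(J, \<theta>)\<close>;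
      the passage from \<open>m\<close> to \<open>N\<close> multiplies the vector by
      \<open>k\<close> anyway.\<close>
    have "represents (scale_form 4 f') (4 * int m)"
      using refined_humbert_represents_transfer[OF J A(2,1) assms(5) A(3)]
        prim_represents_imp_represents[OF A(4)] by simp
    then have "represents f' (int m)" by (simp add: represents_scale_form)
    then show "represents f' N"
      unfolding Nkm f'_def by (rule represents_ternary_form_square)
  qed
qed

end
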